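(* Let $\Sigma\le\mathrm{GL}(n,\mathcal{O}_K)$ be a finite unitary complex reflection group defined over the ring of integers $\mathcal{O}_K$ of a number field $K\subset\mathbb{C}$, let $G\le\Sigma$ be a subgroup of index $\ell$, and let $\theta_*=(\theta_1,\dots,\theta_\ell)$ be a set of secondaries for $K[V]^G$ as a module over $K[V]^\Sigma$. Then $\det M(\theta_* )$ is a scalar multiple of $\Delta(G)$.
   Context: $\Sigma$ is generated by reflections, where a reflection is a non-identity element of $\Sigma$ fixing a hyperplane pointwise. $V=K^n$, $K[V]=K[x_1,\dots,x_n]$ and $\mathcal{O}_K[V]=\mathcal{O}_K[x_1,\dots,x_n]$ with action $(g\cdot f)(v)=f(g^{-1}v)$. $K[V]^\Sigma$ is a polynomial ring. A set of secondaries is a minimal set of homogeneous generators $\theta_1,\dots,\theta_\ell\in\mathcal{O}_K[V]^G$ of $K[V]^G$ as a $K[V]^\Sigma$-module (it has $\ell$ elements and is a basis). Let $\gamma_1,\dots,\gamma_\ell$ be left coset representatives of $G$ in $\Sigma$; $M(\theta_* )=[\gamma_i\theta_j]_{1\le i,j\le\ell}$. Let $\mathcal{P}$ be the set of reflecting hyperplanes of $\Sigma$. For $P\in\mathcal{P}$ let $L_P\in\mathcal{O}_K[V]$ be a linear form with zero set $P$, let $C_P$ be the cyclic subgroup of elements of $\Sigma$ fixing $P$ pointwise, and let $g_P$ be a generator of $C_P$. For $\sigma\in\Sigma$, $b_i(\sigma)$ is the number of cycles of length $i$ of $\sigma$ acting by left multiplication on the set of left cosets $\Sigma/G$. Put $e(G,P)=\sum_{i\ge2}\frac{|C_P|}{2}b_i(g_P)(i-1)$,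 an integer. The $G$-discriminant is $\Delta(G)=\prod_{P\in\mathcal{P}}L_P^{e(G,P)}$, well defined up to a nonzero scalar in $K$. *)

theory Defs
  imports
    "HOL-Analysis.Analysis"
    "HOL-Library.Poly_Mapping"
    "HOL-Combinatorics.Orbits"
    "HOL-Algebra.Left_Coset"
    "HOL-Algebra.Multiplicative_Group"
    "HOL-Algebra.Generated_Groups"
begin

definition number_field :: "complex set \<Rightarrow> bool" where
  "number_field K \<longleftrightarrow>
     0 \<in> K \<and> 1 \<in> K \<and>
     (\<forall>x\<in>K. \<forall>y\<in>K. x + y \<in> K \<and> x * y \<in> K) \<and>
     (\<forall>x\<in>K. - x \<in> K \<and> inverse x \<in> K) \<and>
     (\<exists>B. finite B \<and> B \<subseteq> K \<and> (\<forall>x\<in>K. \<exists>q :: complex \<Rightarrow> rat. x = (\<Sum>b\<in>B. of_rat (q b) * b)))"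

definition ring_of_integers :: "complex set \<Rightarrow> complex set" where
  "ring_of_integers K = {x \<in> K. algebraic_int x}"

text \<open>The formal polynomial ring: monomials are exponent vectors, and a polynomial is a finitely
  supported family of complex coefficients. For a subring \<open>R\<close> of the complex numbers,
  \<open>R[V]\<close> is the subset \<open>polys R\<close>.\<close>

type_synonym 'n mpoly = "('n \<Rightarrow>\<^sub>0 nat) \<Rightarrow>\<^sub>0 complex"

definition polys :: "complex set \<Rightarrow> 'n mpoly set" where
  "polys R = {f. \<forall>m. Poly_Mapping.lookup f m \<in> R}"

definition Const :: "complex \<Rightarrow> 'n mpoly" where
  "Const c = Poly_Mapping.single 0 c"

definition Var :: "'n \<Rightarrow> 'n mpoly" where
  "Var i = Poly_Mapping.single (Poly_Mapping.single i 1) 1"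

definition homogeneous_of_degree :: "nat \<Rightarrow> ('n::finite) mpoly \<Rightarrow> bool" where
  "homogeneous_of_degree d f \<longleftrightarrow> (\<forall>m\<in>Poly_Mapping.keys f. (\<Sum>i\<in>UNIV. Poly_Mapping.lookup m i) = d)"

definition homogeneous :: "('n::finite) mpoly \<Rightarrow> bool" where
  "homogeneous f \<longleftrightarrow> (\<exists>d. homogeneous_of_degree d f)"

definition poly_eval :: "('n::finite) mpoly \<Rightarrow> complex^'n \<Rightarrow> complex" where
  "poly_eval f v = (\<Sum>m\<in>Poly_Mapping.keys f. Poly_Mapping.lookup f m * (\<Prod>i\<in>UNIV. (v $ i) ^ Poly_Mapping.lookup m i))"

definition poly_subst :: "('n \<Rightarrow> 'n mpoly) \<Rightarrow> ('n::finite) mpoly \<Rightarrow> 'n mpoly" where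
  "poly_subst s f = (\<Sum>m\<in>Poly_Mapping.keys f. Const (Poly_Mapping.lookup f m) * (\<Prod>i\<in>UNIV. s i ^ Poly_Mapping.lookup m i))"

text \<open>The action \<open>(g \<cdot> f)(v) = f(g\<inverse> v)\<close>, as the substitution of the coordinates
  of \<open>g\<inverse> v\<close> for the variables; see \<open>poly_eval_act\<close> below.\<close>

definition act :: "complex^'n^'n \<Rightarrow> ('n::finite) mpoly \<Rightarrow> 'n mpoly" where
  "act g f = poly_subst (\<lambda>i. \<Sum>j\<in>UNIV. Const (matrix_inv g $ i $ j) * Var j) f"

lemma poly_eval_superset:
  assumes "finite A" "Poly_Mapping.keys f \<subseteq> A"
  shows "poly_eval f v = (\<Sum>m\<in>A. Poly_Mapping.lookup f m * (\<Prod>i\<in>UNIV. (v $ i) ^ Poly_Mapping.lookup m i))"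
  unfolding poly_eval_def using assms
  by (intro sum.mono_neutral_left) (auto simp: in_keys_iff)

lemma poly_eval_zero: "poly_eval 0 v = 0"
  by (simp add: poly_eval_def)

lemma poly_eval_add: "poly_eval (f + g) v = poly_eval f v + poly_eval g v"
proof -
  let ?A = "Poly_Mapping.keys f \<union> Poly_Mapping.keys g"
  have "Poly_Mapping.keys (f + g) \<subseteq> ?A" by (rule Poly_Mapping.keys_add)
  then show ?thesis
    by (simp add: poly_eval_superset[where A = ?A] lookup_add algebra_simps sum.distrib)
qed

lemma poly_eval_sum: "poly_eval (\<Sum>x\<in>A. F x) v = (\<Sum>x\<in>A. poly_eval (F x) v)"
  by (induction A rule: infinite_finite_induct) (simp_all add: poly_eval_zero poly_eval_add)

lemma poly_eval_single:
  "poly_eval (Poly_Mapping.single m c) v = c * (\<Prod>i\<in>UNIV. (v $ i) ^ Poly_Mapping.lookup m i)"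
  by (simp add: poly_eval_superset[where A = "{m}"])

lemma poly_eval_mult: "poly_eval (f * g) v = poly_eval f v * poly_eval g v"
proof -
  have rep: "h = (\<Sum>m\<in>Poly_Mapping.keys h. Poly_Mapping.single m (Poly_Mapping.lookup h m))" for h :: "'a mpoly"
    by (rule poly_mapping_eqI)
       (simp add: lookup_sum lookup_single when_def in_keys_iff)
  have "f * g = (\<Sum>m\<in>Poly_Mapping.keys f. \<Sum>k\<in>Poly_Mapping.keys g. Poly_Mapping.single (m + k) (Poly_Mapping.lookup f m * Poly_Mapping.lookup g k))"
    by (subst rep[of f], subst rep[of g]) (simp add: sum_product mult_single)
  then show ?thesis
    by (simp add: poly_eval_sum poly_eval_single lookup_add power_add prod.distrib)
       (simp add: poly_eval_def sum_product algebra_simps)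
qed

lemma poly_eval_Const: "poly_eval (Const c) v = c"
  by (simp add: Const_def poly_eval_single)

lemma poly_eval_Var: "poly_eval (Var i) v = v $ i"
proof -
  have "(\<Prod>j\<in>UNIV. (v $ j) ^ Poly_Mapping.lookup (Poly_Mapping.single i (1::nat)) j) =
        (\<Prod>j\<in>UNIV. if i = j then v $ j else 1)"
    by (intro prod.cong) (auto simp: lookup_single)
  then show ?thesis by (simp add: Var_def poly_eval_single)
qed

lemma poly_eval_power: "poly_eval (f ^ k) v = poly_eval f v ^ k"
  using poly_eval_Const[of 1 v]
  by (induction k) (simp_all add: poly_eval_mult Const_def)

lemma poly_eval_prod: "poly_eval (\<Prod>x\<in>A. F x) v = (\<Prod>x\<in>A. poly_eval (F x) v)"
  using poly_eval_Const[of 1 v]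
  by (induction A rule: infinite_finite_induct) (simp_all add: poly_eval_mult Const_def)

lemma poly_eval_act: "poly_eval (act g f) v = poly_eval f (matrix_inv g *v v)"
  by (simp add: act_def poly_subst_def poly_eval_sum poly_eval_mult poly_eval_Const
      poly_eval_Var poly_eval_prod poly_eval_power)
     (simp add: poly_eval_def matrix_vector_mult_def)

definition matrix_monoid :: "complex set \<Rightarrow> (complex^'n::finite^'n) monoid" where
  "matrix_monoid R = \<lparr>carrier = {A. \<forall>i j. A $ i $ j \<in> R}, monoid.mult = (**), one = mat 1\<rparr>"

definition GL :: "complex set \<Rightarrow> (complex^'n::finite^'n) monoid" where
  "GL R = units_of (matrix_monoid R)"

abbreviation grp :: "complex set \<Rightarrow> (complex^'n::finite^'n) set \<Rightarrow> (complex^'n^'n) monoid" where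
  "grp K S \<equiv> (GL (ring_of_integers K))\<lparr>carrier := S\<rparr>"

definition space_over :: "complex set \<Rightarrow> (complex^'n) set" where
  "space_over K = {v. \<forall>i. v $ i \<in> K}"

definition hyperplane :: "complex set \<Rightarrow> (complex^'n::finite) set \<Rightarrow> bool" where
  "hyperplane K P \<longleftrightarrow>
     (\<exists>a\<in>space_over K. a \<noteq> 0 \<and> P = {v \<in> space_over K. (\<Sum>i\<in>UNIV. a $ i * v $ i) = 0})"

definition pointwise_stabilizer ::
    "(complex^'n::finite^'n) set \<Rightarrow> (complex^'n) set \<Rightarrow> (complex^'n^'n) set" where
  "pointwise_stabilizer S P = {s \<in> S. \<forall>v\<in>P. s *v v = v}"

definition reflections ::
    "complex set \<Rightarrow> (complex^'n::finite^'n) set \<Rightarrow> (complex^'n^'n) set" where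
  "reflections K S =
     {s \<in> S. s \<noteq> mat 1 \<and> (\<exists>P. hyperplane K P \<and> s \<in> pointwise_stabilizer S P)}"

definition reflecting_hyperplanes ::
    "complex set \<Rightarrow> (complex^'n::finite^'n) set \<Rightarrow> (complex^'n) set set" where
  "reflecting_hyperplanes K S =
     {P. hyperplane K P \<and> (\<exists>s. s \<noteq> mat 1 \<and> s \<in> pointwise_stabilizer S P)}"

definition sesquilinear :: "complex^'n::finite^'n \<Rightarrow> complex^'n \<Rightarrow> complex^'n \<Rightarrow> complex" where
  "sesquilinear H u v = (\<Sum>i\<in>UNIV. \<Sum>j\<in>UNIV. cnj (u $ i) * H $ i $ j * v $ j)"

text \<open>Unitary with respect to some positive definite Hermitian form, not necessarily the
  standard one.\<close>

definition unitary_group :: "(complex^'n::finite^'n) set \<Rightarrow> bool" where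
  "unitary_group S \<longleftrightarrow>
     (\<exists>H. (\<forall>u v. sesquilinear H v u = cnj (sesquilinear H u v)) \<and>
          (\<forall>v. v \<noteq> 0 \<longrightarrow> Re (sesquilinear H v v) > 0) \<and>
          (\<forall>s\<in>S. \<forall>u v. sesquilinear H (s *v u) (s *v v) = sesquilinear H u v))"

definition finite_unitary_reflection_group ::
    "complex set \<Rightarrow> (complex^'n::finite^'n) set \<Rightarrow> bool" where
  "finite_unitary_reflection_group K S \<longleftrightarrow>
     finite S \<and> subgroup S (GL (ring_of_integers K)) \<and> unitary_group S \<and>
     generate (GL (ring_of_integers K)) (reflections K S) = S"

definition invariants ::
    "complex set \<Rightarrow> (complex^'n::finite^'n) set \<Rightarrow> 'n mpoly set" where
  "invariants R G = {f \<in> polys R. \<forall>g\<in>G. act g f = f}"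

definition generates_invariants ::
    "complex set \<Rightarrow> (complex^'n::finite^'n) set \<Rightarrow> (complex^'n^'n) set \<Rightarrow>
     ('l \<Rightarrow> 'n mpoly) \<Rightarrow> 'l set \<Rightarrow> bool" where
  "generates_invariants K S G \<theta> J \<longleftrightarrow>
     (\<forall>j\<in>J. \<theta> j \<in> invariants K G) \<and>
     (\<forall>f\<in>invariants K G. \<exists>c. (\<forall>j\<in>J. c j \<in> invariants K S) \<and> f = (\<Sum>j\<in>J. c j * \<theta> j))"

text \<open>Minimality is with respect to inclusion of index sets; in particular a minimal family is
  injective.\<close>

definition secondaries ::
    "complex set \<Rightarrow> (complex^'n::finite^'n) set \<Rightarrow> (complex^'n^'n) set \<Rightarrow>
     ('l::finite \<Rightarrow> 'n mpoly) \<Rightarrow> bool" where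
  "secondaries K S G \<theta> \<longleftrightarrow>
     (\<forall>j. \<theta> j \<in> invariants (ring_of_integers K) G \<and> homogeneous (\<theta> j)) \<and>
     generates_invariants K S G \<theta> UNIV \<and>
     (\<forall>J. J \<subset> UNIV \<longrightarrow> \<not> generates_invariants K S G \<theta> J)"

definition left_coset_reps ::
    "complex set \<Rightarrow> (complex^'n::finite^'n) set \<Rightarrow> (complex^'n^'n) set \<Rightarrow>
     ('l \<Rightarrow> complex^'n^'n) \<Rightarrow> bool" where
  "left_coset_reps K S G \<gamma> \<longleftrightarrow>
     range \<gamma> \<subseteq> S \<and> bij_betw (\<lambda>i. \<gamma> i <#\<^bsub>grp K S\<^esub> G) UNIV (lcosets\<^bsub>grp K S\<^esub> G)"

definition secondary_matrix ::
    "('l::finite \<Rightarrow> complex^'n::finite^'n) \<Rightarrow> ('l \<Rightarrow> 'n mpoly) \<Rightarrow> 'n mpoly^'l^'l" where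
  "secondary_matrix \<gamma> \<theta> = (\<chi> i j. act (\<gamma> i) (\<theta> j))"

definition num_cycles ::
    "complex set \<Rightarrow> (complex^'n::finite^'n) set \<Rightarrow> (complex^'n^'n) set \<Rightarrow> nat \<Rightarrow>
     complex^'n^'n \<Rightarrow> nat" where
  "num_cycles K S G i s =
     card {Z \<in> orbit (\<lambda>X. s <#\<^bsub>grp K S\<^esub> X) ` (lcosets\<^bsub>grp K S\<^esub> G). card Z = i}"

text \<open>A cycle has length at most the number of cosets, so the sum over \<open>i \<ge> 2\<close> is finite.\<close>

definition twice_discr_exponent ::
    "complex set \<Rightarrow> (complex^'n::finite^'n) set \<Rightarrow> (complex^'n^'n) set \<Rightarrow>
     (complex^'n) set \<Rightarrow> complex^'n^'n \<Rightarrow> nat" where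
  "twice_discr_exponent K S G P g =
     (\<Sum>i = 2..card (lcosets\<^bsub>grp K S\<^esub> G).
        card (pointwise_stabilizer S P) * num_cycles K S G i g * (i - 1))"

text \<open>The division by 2 is exact when \<open>g\<close> generates the pointwise stabilizer of \<open>P\<close>;
  see \<open>even_twice_discr_exponent\<close>.\<close>

definition discr_exponent ::
    "complex set \<Rightarrow> (complex^'n::finite^'n) set \<Rightarrow> (complex^'n^'n) set \<Rightarrow>
     (complex^'n) set \<Rightarrow> complex^'n^'n \<Rightarrow> nat" where
  "discr_exponent K S G P g = twice_discr_exponent K S G P g div 2"

lemma card_orbit_dvd:
  assumes "(f ^^ N) x = x" "N > 0"
  shows "card (orbit f x) dvd N"
proof -
  let ?d = "funpow_dist1 f x x"
  have x: "x \<in> orbit f x" using assms by (auto simp: orbit_altdef) metis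
  have card: "card (orbit f x) = ?d"
    by (subst orbit_conv_funpow_dist1[OF x]) (simp only: card_image[OF inj_on_funpow_dist1[OF x]] card_atLeastLessThan diff_zero)
  have "(f ^^ (N mod ?d)) x = x"
    using funpow_mod_eq[where f = f and x = x and n = ?d and m = N] funpow_dist1_prop[OF x] assms(1)
    by simp
  then have "\<not> 0 < N mod ?d"
    using funpow_dist1_least[of "N mod ?d" f x x] by (metis mod_less_divisor zero_less_Suc)
  then show ?thesis unfolding card by (simp add: dvd_eq_mod_eq_0)
qed

lemma group_grp:
  assumes "finite_unitary_reflection_group K S"
  shows "group (grp K S)"
proof -
  let ?GL = "GL (ring_of_integers K) :: (complex^'a^'a) monoid"
  have sg: "subgroup S ?GL"
    using assms by (simp add: finite_unitary_reflection_group_def)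
  have m: "monoid.mult ?GL = (**)" "one ?GL = mat 1"
    by (simp_all add: GL_def units_of_def matrix_monoid_def)
  show ?thesis
  proof (rule groupI)
    fix x assume "x \<in> carrier (grp K S)"
    then have x: "x \<in> S" by simp
    then have "x \<in> Units (matrix_monoid (ring_of_integers K))"
      using subgroup.subset[OF sg] by (auto simp: GL_def units_of_def)
    then obtain y where y: "y \<in> carrier ?GL" "y ** x = mat 1" "x ** y = mat 1"
      by (auto simp: GL_def units_of_def Units_def matrix_monoid_def)
    have "inv\<^bsub>?GL\<^esub> x = y"
      unfolding m_inv_def m using y
      by (intro the_equality) (auto, metis matrix_mul_assoc matrix_mul_lid matrix_mul_rid)
    then have "y \<in> S" using subgroup.m_inv_closed[OF sg x] by simp
    then show "\<exists>y\<in>carrier (grp K S). y \<otimes>\<^bsub>grp K S\<^esub> x = \<one>\<^bsub>grp K S\<^esub>"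
      using y by (auto simp: m)
  qed (use subgroup.m_closed[OF sg] subgroup.one_closed[OF sg] in
      \<open>auto simp: m matrix_mul_assoc\<close>)
qed

lemma even_twice_discr_exponent:
  assumes S: "finite_unitary_reflection_group K S"
    and G: "subgroup G (grp K S)"
    and g: "generate (grp K S) {g} = pointwise_stabilizer S P"
  shows "even (twice_discr_exponent K S G P g)"
proof (cases "even (card (pointwise_stabilizer S P))")
  case True
  then show ?thesis by (auto simp: twice_discr_exponent_def intro!: dvd_sum)
next
  case False
  let ?C = "pointwise_stabilizer S P" and ?H = "grp K S"
  interpret group ?H by (rule group_grp[OF S])
  have gC: "g \<in> ?C" using g generate.incl[of g "{g}" ?H] by auto
  then have gS: "g \<in> carrier ?H" by (simp add: pointwise_stabilizer_def)
  have C: "subgroup ?C ?H" using generate_is_subgroup[of "{g}"] gS g by simp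
  have "g [^]\<^bsub>?H\<lparr>carrier := ?C\<rparr>\<^esub> order (?H\<lparr>carrier := ?C\<rparr>) = \<one>\<^bsub>?H\<lparr>carrier := ?C\<rparr>\<^esub>"
    by (rule group.pow_order_eq_1[OF subgroup.subgroup_is_group[OF C group_axioms]]) (simp add: gC)
  then have pow: "g [^]\<^bsub>?H\<^esub> card ?C = \<one>\<^bsub>?H\<^esub>"
    by (simp add: order_def nat_pow_def)
  have odd_len: "odd (card (orbit (\<lambda>X. g <#\<^bsub>?H\<^esub> X) X))" if X: "X \<in> lcosets\<^bsub>?H\<^esub> G" for X
  proof -
    have XS: "X \<subseteq> carrier ?H" by (rule subgroup.lcosets_carrier[OF G group_axioms X])
    have "((\<lambda>X. g <#\<^bsub>?H\<^esub> X) ^^ k) X = (g [^]\<^bsub>?H\<^esub> k) <#\<^bsub>?H\<^esub> X" for k :: nat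
    proof (induction k)
      case 0
      then show ?case using lcos_mult_one[OF XS] by simp
    next
      case (Suc k)
      then show ?case
        using lcos_m_assoc[OF XS gS nat_pow_closed[OF gS]] nat_pow_Suc2[OF gS, of k] by simp
    qed
    then have "((\<lambda>X. g <#\<^bsub>?H\<^esub> X) ^^ card ?C) X = X"
      using pow lcos_mult_one[OF XS] by simp
    moreover have "card ?C > 0" using False by (cases "card ?C") auto
    ultimately have "card (orbit (\<lambda>X. g <#\<^bsub>?H\<^esub> X) X) dvd card ?C" by (rule card_orbit_dvd)
    then show ?thesis using False dvd_trans by blast
  qed
  have "even (card ?C * num_cycles K S G i g * (i - 1))" if "i \<ge> 2" for i
  proof (cases "odd i")
    case True
    then show ?thesis by simp
  next
    case False
    have "{Z \<in> orbit (\<lambda>X. g <#\<^bsub>?H\<^esub> X) ` (lcosets\<^bsub>?H\<^esub> G). card Z = i} = {}"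
      using odd_len False by auto
    then show ?thesis by (simp only: num_cycles_def card.empty) simp
  qed
  then show ?thesis
    unfolding twice_discr_exponent_def by (intro dvd_sum) simp
qed

definition defining_forms ::
    "complex set \<Rightarrow> (complex^'n::finite^'n) set \<Rightarrow> ((complex^'n) set \<Rightarrow> 'n mpoly) \<Rightarrow> bool" where
  "defining_forms K S L \<longleftrightarrow>
     (\<forall>P\<in>reflecting_hyperplanes K S.
        L P \<in> polys (ring_of_integers K) \<and> homogeneous_of_degree 1 (L P) \<and>
        {v \<in> space_over K. poly_eval (L P) v = 0} = P)"

definition stabilizer_generators ::
    "complex set \<Rightarrow> (complex^'n::finite^'n) set \<Rightarrow> ((complex^'n) set \<Rightarrow> complex^'n^'n) \<Rightarrow> bool" where
  "stabilizer_generators K S g \<longleftrightarrow>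
     (\<forall>P\<in>reflecting_hyperplanes K S. generate (grp K S) {g P} = pointwise_stabilizer S P)"

definition discriminant ::
    "complex set \<Rightarrow> (complex^'n::finite^'n) set \<Rightarrow> (complex^'n^'n) set \<Rightarrow>
     ((complex^'n) set \<Rightarrow> 'n mpoly) \<Rightarrow> ((complex^'n) set \<Rightarrow> complex^'n^'n) \<Rightarrow> 'n mpoly" where
  "discriminant K S G L g =
     (\<Prod>P\<in>reflecting_hyperplanes K S. L P ^ discr_exponent K S G P (g P))"

end

theory Submission
  imports Defs "HOL-Computational_Algebra.Fundamental_Theorem_Algebra"
begin

text \<open>Both sides of the asserted identity are homogeneous polynomials, so they can be compared on the
  lines \<open>v + t w\<close> of a generic direction \<open>w\<close>. On such a line each becomes a univariate complex
  polynomial in \<open>t\<close>, its leading coefficient is its value at \<open>w\<close>, and it is determined by that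
  coefficient and by its order of vanishing at every \<open>t\<close>. If these orders agree for generic \<open>v\<close>, then
  the two sides agree at generic \<open>v\<close> up to the factor \<open>c\<close> which is the quotient of their values at
  \<open>w\<close>, hence everywhere; and \<open>c\<close> lies in \<open>K\<close> as soon as \<open>w\<close> has coordinates in \<open>K\<close>.

  A generic line also avoids, by a dimension count, the fixed spaces of codimension at least two and
  the intersections of distinct hyperplanes. The stabilizer in \<open>\<Sigma>\<close> of a point \<open>p\<close> of the line is
  therefore trivial or the cyclic group \<open>C_P\<close> of a single reflecting hyperplane \<open>P\<close>
  (\<open>stabilizer_on_generic_line\<close>). The
  discriminant vanishes at \<open>p\<close> to order \<open>0\<close> or \<open>e(G,P)\<close> accordingly, and the same has to be shown for
  \<open>det M(\<theta>)\<close>.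

  This is a local computation at \<open>p\<close>. Let \<open>g\<close> generate the stabilizer, let \<open>m\<close> be its order and
  \<open>\<zeta>\<close> its eigenvalue transversal to \<open>P\<close>. A \<open>G\<close>-invariant \<open>f\<close> defines a function \<open>\<gamma> f\<close> for every coset
  \<open>\<gamma> G\<close>, and \<open>g\<close> permutes these functions as it permutes the cosets. On a cycle of length \<open>k\<close> the
  discrete Fourier transform splits them into eigenfunctions of \<open>g\<close>, and an eigenfunction with
  eigenvalue \<open>\<zeta>\<close> to the power \<open>r m/k\<close>, up to sign of the exponent, is divisible by the \<open>r m/k\<close>-th power
  of a linear form of \<open>P\<close>. Thus \<open>M(\<theta>)\<close> factors as a constant invertible matrix \<open>V\<close> times a diagonal
  matrix of powers times another matrix (\<open>lower_factor\<close>), and the cycle contributes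
  \<open>0 + m/k + \<dots> + (k-1) m/k = m (k-1)/2\<close> to the order, in sum \<open>e(G,P)\<close>.

  For the opposite inequality one exhibits invariants \<open>f_1, \<dots>, f_\<ell>\<close> for which the last factor is
  invertible at \<open>p\<close>: by averaging over \<open>G\<close> a polynomial that has a prescribed jet at one point of the
  orbit of \<open>p\<close> and vanishes to high order at the others (\<open>upper_invariant\<close>). As the \<open>\<theta>_j\<close> generate, the
  \<open>f_j\<close> are combinations of them with \<open>\<Sigma>\<close>-invariant coefficients, so \<open>det M(\<theta>)\<close> divides
  \<open>det [\<gamma>_i f_j]\<close>, whose order is exactly \<open>e(G,P)\<close> (\<open>line_matrix_upper\<close>). With trivial stabilizer the
  same argument shows that \<open>det M(\<theta>)\<close> does not vanish at \<open>p\<close>.\<close>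


section \<open>Polynomials, lines and determinants\<close>

definition linform :: "complex^'n::finite \<Rightarrow> complex^'n \<Rightarrow> complex" where
  "linform a v = (\<Sum>i\<in>UNIV. a $ i * v $ i)"

lemma linform_simps [simp]:
  "linform a (u + v) = linform a u + linform a v"
  "linform a (u - v) = linform a u - linform a v"
  "linform a (c *s v) = c * linform a v"
  "linform a 0 = 0"
  "linform (a + b) v = linform a v + linform b v"
  "linform (a - b) v = linform a v - linform b v"
  "linform (c *s a) v = c * linform a v"
  "linform 0 v = 0"
  by (simp_all add: linform_def algebra_simps sum.distrib sum_subtractf sum_distrib_left)

lemma linform_axis_left [simp]: "linform (axis i 1) v = v $ i"
  by (simp add: linform_def axis_def if_distrib[of "\<lambda>x. x * _"] cong: if_cong)

text \<open>On the moment curve, whose points have pairwise different powers of one number \<open>x\<close> as coordinates,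
  a nonzero linear form becomes a nonzero univariate polynomial in \<open>x\<close>. Natural coordinates ensure
  that the point lies in the space over every number field.\<close>

lemma exists_nat_point_off_hyperplanes:
  fixes A :: "(complex^'n::finite) set"
  assumes "finite A" "0 \<notin> A"
  shows "\<exists>N :: 'n \<Rightarrow> nat. \<forall>a\<in>A. linform a (\<chi> i. of_nat (N i)) \<noteq> 0"
proof -
  obtain idx :: "'n \<Rightarrow> nat" where inj: "inj idx"
    using finite_imp_inj_to_nat_seg[of "UNIV :: 'n set"] by auto
  define q where "q a = (\<Sum>i\<in>UNIV. Polynomial.monom (a $ i) (idx i))" for a :: "complex^'n"
  have q0: "q a \<noteq> 0" if "a \<noteq> 0" for a
  proof -
    have "\<exists>i. a $ i \<noteq> 0" using that by (simp add: vec_eq_iff)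
    then obtain i where i: "a $ i \<noteq> 0" by blast
    have "Polynomial.coeff (q a) (idx i) = (\<Sum>j\<in>UNIV. if j = i then a $ j else 0)"
      unfolding q_def Polynomial.coeff_sum by (intro sum.cong) (auto simp: inj_eq[OF inj])
    then show ?thesis using i by auto
  qed
  let ?R = "(\<Union>a\<in>A. {x. poly (q a) x = 0})"
  have "finite {x. poly (q a) x = 0}" if "a \<in> A" for a
    using assms q0[of a] that by (intro poly_roots_finite) auto
  then have "finite ?R" using assms by simp
  moreover have "infinite (range of_nat :: complex set)"
    using infinite_UNIV_nat finite_imageD[OF _ inj_of_nat] by blast
  ultimately have "\<not> range of_nat \<subseteq> ?R" using finite_subset by blast
  then obtain x :: nat where x: "of_nat x \<notin> ?R" by blast
  have "linform a (\<chi> i. of_nat (x ^ idx i)) = poly (q a) (of_nat x)" for a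
    by (simp add: linform_def q_def poly_sum poly_monom)
  then show ?thesis using x by (intro exI[of _ "\<lambda>i. x ^ idx i"]) auto
qed

lemma poly_eval_minus: "poly_eval (- f) v = - poly_eval f v"
  using poly_eval_add[of f "- f" v] by (simp add: poly_eval_zero add_eq_0_iff2)

lemma poly_eval_diff: "poly_eval (f - g) v = poly_eval f v - poly_eval g v"
  using poly_eval_add[of f "- g" v] by (simp add: poly_eval_minus)

lemma poly_eval_one: "poly_eval 1 v = 1"
  using poly_eval_Const[of 1 v] by (simp add: Const_def)

lemmas poly_eval_simps = poly_eval_zero poly_eval_one poly_eval_add poly_eval_minus poly_eval_diff
  poly_eval_sum poly_eval_mult poly_eval_Const poly_eval_Var poly_eval_power poly_eval_prod

text \<open>Weights \<open>N i\<close> chosen off finitely many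
  hyperplanes give distinct weighted degrees to the monomials of \<open>f\<close>, so the substitution of
  \<open>t ^ N i\<close> for the variables keeps their coefficients apart.\<close>

lemma poly_eval_eq_zeroD:
  fixes f :: "'n::finite mpoly"
  assumes "\<And>v. poly_eval f v = 0"
  shows "f = 0"
proof (rule ccontr)
  assume "f \<noteq> 0"
  then obtain m0 where m0: "m0 \<in> Poly_Mapping.keys f" by fastforce
  define K where "K = Poly_Mapping.keys f"
  define D where "D m m' = ((\<chi> i. of_nat (Poly_Mapping.lookup m i) - of_nat (Poly_Mapping.lookup m' i)) :: complex^'n)"
    for m m' :: "'n \<Rightarrow>\<^sub>0 nat"
  have D0: "D m m' = 0 \<Longrightarrow> m = m'" for m m'
    by (rule poly_mapping_eqI) (simp add: D_def vec_eq_iff)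
  define DD where "DD = (\<lambda>(m, m'). D m m') ` {(m, m') \<in> K \<times> K. m \<noteq> m'}"
  have "finite {(m, m') \<in> K \<times> K. m \<noteq> m'}"
    by (rule finite_subset[of _ "K \<times> K"]) (auto simp: K_def)
  then have "finite DD" by (simp add: DD_def)
  moreover have "0 \<notin> DD"
  proof
    assume "0 \<in> DD"
    then obtain m m' where "0 = D m m'" "m \<noteq> m'" unfolding DD_def by (elim imageE) auto
    then show False using D0[of m m'] by metis
  qed
  ultimately obtain N where N: "\<forall>a\<in>DD. linform a (\<chi> i. of_nat (N i)) \<noteq> 0"
    using exists_nat_point_off_hyperplanes by blast
  define wt where "wt m = (\<Sum>i\<in>UNIV. N i * Poly_Mapping.lookup m i)" for m :: "'n \<Rightarrow>\<^sub>0 nat"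
  have inj: "m = m'" if "m \<in> K" "m' \<in> K" "wt m = wt m'" for m m'
  proof (rule ccontr)
    assume "m \<noteq> m'"
    then have "D m m' \<in> DD" using that unfolding DD_def by (intro image_eqI[of _ _ "(m, m')"]) auto
    then have "linform (D m m') (\<chi> i. of_nat (N i)) \<noteq> 0" using N by blast
    moreover have "linform (D m m') (\<chi> i. of_nat (N i)) = of_nat (wt m) - of_nat (wt m')"
      by (simp add: linform_def D_def wt_def algebra_simps sum_subtractf)
    ultimately show False using that(3) by simp
  qed
  define q where "q = (\<Sum>m\<in>K. Polynomial.monom (Poly_Mapping.lookup f m) (wt m))"
  have "poly q t = poly_eval f (\<chi> i. t ^ N i)" for t
    by (simp add: q_def poly_sum poly_monom poly_eval_def K_def wt_def power_sum power_mult)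
  then have "\<And>t. poly q t = 0" using assms by simp
  then have q0: "q = 0" using poly_all_0_iff_0 by blast
  have "Polynomial.coeff q (wt m0) = (\<Sum>m\<in>K. if m = m0 then Poly_Mapping.lookup f m else 0)"
    unfolding q_def Polynomial.coeff_sum using inj m0 by (intro sum.cong) (auto simp: K_def)
  also have "\<dots> = Poly_Mapping.lookup f m0"
    using m0 by (subst sum.delta) (simp_all add: K_def)
  finally have "Poly_Mapping.lookup f m0 = 0" unfolding q0 coeff_0 by (rule sym)
  with m0 show False unfolding in_keys_iff by contradiction
qed

lemma poly_eval_inject:
  fixes f g :: "'n::finite mpoly"
  assumes "\<And>v. poly_eval f v = poly_eval g v"
  shows "f = g"
proof -
  have "f - g = 0" by (rule poly_eval_eq_zeroD) (simp only: poly_eval_diff assms diff_self)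
  then show ?thesis by (simp only: right_minus_eq)
qed

definition line_poly :: "('n::finite) mpoly \<Rightarrow> complex^'n \<Rightarrow> complex^'n \<Rightarrow> complex poly" where
  "line_poly f p w = (\<Sum>m\<in>Poly_Mapping.keys f. Polynomial.smult (Poly_Mapping.lookup f m)
     (\<Prod>i\<in>UNIV. [:p $ i, w $ i:] ^ Poly_Mapping.lookup m i))"

lemma poly_line_poly: "poly (line_poly f p w) t = poly_eval f (p + t *s w)"
  by (simp add: line_poly_def poly_eval_def poly_sum poly_prod)

lemma poly_eqI_all:
  fixes p q :: "'a::{comm_ring_1,ring_no_zero_divisors,ring_char_0} poly"
  assumes "\<And>t. poly p t = poly q t" shows "p = q"
  using assms by (metis ext poly_eq_poly_eq_iff)

text \<open>The set where none of the forms in \<open>A\<close> vanishes is dense: any point lies on a line that leaves this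
  set at finitely many parameters only.\<close>

lemma poly_eval_generic_eq:
  fixes f g :: "'n::finite mpoly"
  assumes A: "finite A" "0 \<notin> A"
    and eq: "\<And>v. (\<And>a. a \<in> A \<Longrightarrow> linform a v \<noteq> 0) \<Longrightarrow> poly_eval f v = poly_eval g v"
  shows "f = g"
proof (rule poly_eval_inject)
  fix v
  obtain N where N: "\<forall>a\<in>A. linform a (\<chi> i. of_nat (N i)) \<noteq> 0"
    using exists_nat_point_off_hyperplanes[OF A] by blast
  define w :: "complex^'n" where "w = (\<chi> i. of_nat (N i))"
  let ?B = "(\<lambda>a. - linform a v / linform a w) ` A"
  have "poly (line_poly f v w - line_poly g v w) t = 0" if "t \<notin> ?B" for t
  proof -
    have "poly_eval f (v + t *s w) = poly_eval g (v + t *s w)"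
    proof (rule eq)
      fix a assume a: "a \<in> A"
      then have "linform a w \<noteq> 0" "t \<noteq> - linform a v / linform a w"
        using N that by (auto simp: w_def)
      then show "linform a (v + t *s w) \<noteq> 0" by (auto simp: field_simps add_eq_0_iff)
    qed
    then show ?thesis by (simp add: poly_line_poly)
  qed
  then have "UNIV - ?B \<subseteq> {t. poly (line_poly f v w - line_poly g v w) t = 0}" by blast
  moreover have "infinite (UNIV - ?B)" using A infinite_UNIV_char_0 by (simp add: Diff_infinite_finite)
  ultimately have "line_poly f v w - line_poly g v w = 0"
    using poly_roots_finite finite_subset by blast
  then have "poly (line_poly f v w) 0 = poly (line_poly g v w) 0" by simp
  then show "poly_eval f v = poly_eval g v" by (simp add: poly_line_poly)
qed

lemma det_ring_hom:
  fixes h :: "'a::comm_ring_1 \<Rightarrow> 'b::comm_ring_1" and A :: "'a^'l^'l"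
  assumes add: "\<And>x y. h (x + y) = h x + h y" and mult: "\<And>x y. h (x * y) = h x * h y" and one: "h 1 = 1"
  shows "h (det A) = det (\<chi> i j. h (A $ i $ j))"
proof -
  have zero: "h 0 = 0" using add[of 0 0] by simp
  have minus: "h (- x) = - h x" for x using add[of x "- x"] zero by (simp add: add_eq_0_iff2)
  have sum: "h (sum f B) = (\<Sum>x\<in>B. h (f x))" for f :: "('l \<Rightarrow> 'l) \<Rightarrow> 'a" and B
    by (induction B rule: infinite_finite_induct) (simp_all add: zero add)
  have prod: "h (prod f B) = (\<Prod>x\<in>B. h (f x))" for f :: "'l \<Rightarrow> 'a" and B
    by (induction B rule: infinite_finite_induct) (simp_all add: one mult)
  have sgn: "h (of_int (sign p)) = of_int (sign p)" for p :: "'l \<Rightarrow> 'l"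
    by (cases p rule: sign_cases) (simp_all add: one minus)
  show ?thesis by (simp add: det_def sum mult prod sgn)
qed

lemma poly_eval_det:
  "poly_eval (det A) v = det (\<chi> i j. poly_eval (A $ i $ j) v)"
  by (rule det_ring_hom) (simp_all add: poly_eval_simps)

lemma poly_det: "poly (det A) t = det (\<chi> i j. poly (A $ i $ j) t)"
  for A :: "(complex poly)^'l^'l"
  by (rule det_ring_hom) simp_all

lemma dvd_prod_diff:
  fixes f g :: "'a \<Rightarrow> 'b::comm_ring_1"
  assumes "\<And>x. x \<in> A \<Longrightarrow> d dvd f x - g x"
  shows "d dvd prod f A - prod g A"
  using assms
proof (induction A rule: infinite_finite_induct)
  case (insert x A)
  have "f x * prod f A - g x * prod g A = (f x - g x) * prod f A + g x * (prod f A - prod g A)"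
    by (simp add: algebra_simps)
  then show ?case using insert by (simp add: dvd_add dvd_mult dvd_mult2)
qed simp_all

lemma dvd_det_diff:
  fixes A B :: "'a::comm_ring_1^'l^'l"
  assumes "\<And>i j. d dvd A $ i $ j - B $ i $ j"
  shows "d dvd det A - det B"
  unfolding det_def sum_subtractf[symmetric] right_diff_distrib[symmetric]
  by (intro dvd_sum dvd_mult dvd_prod_diff assms)

lemma det_scale_columns:
  fixes A :: "'a::comm_ring_1^'l^'l"
  shows "det (\<chi> i j. A $ i $ j * c j) = det A * prod c UNIV"
proof -
  let ?D = "(\<chi> i j. if i = j then c i else 0) :: 'a^'l^'l"
  have "(\<chi> i j. A $ i $ j * c j) = A ** ?D"
    by (simp add: vec_eq_iff matrix_matrix_mult_def if_distrib[of "(*) _"] cong: if_cong)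
  moreover have "det ?D = prod c UNIV" by (subst det_diagonal) simp_all
  ultimately show ?thesis by (simp add: det_mul)
qed

lemma det_scale_rows:
  fixes A :: "'a::comm_ring_1^'l^'l"
  shows "det (\<chi> i j. c i * A $ i $ j) = prod c UNIV * det A"
proof -
  have "det (\<chi> i j. c i * A $ i $ j) = det (transpose (\<chi> i j. transpose A $ i $ j * c j))"
    by (simp add: transpose_def mult.commute)
  then show ?thesis by (simp only: det_transpose det_scale_columns) (simp add: mult.commute)
qed

section \<open>Cycles of a periodic map and their Fourier matrix\<close>

text \<open>The map \<open>f\<close> abstracts the action on the left cosets of \<open>G\<close> of a generator of the stabilizer
  of a point, and \<open>m\<close> is the order of that generator.\<close>

locale periodic_map =
  fixes f :: "'x \<Rightarrow> 'x" and \<Omega> :: "'x set" and m :: nat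
  assumes finite_domain: "finite \<Omega>"
    and closed: "X \<in> \<Omega> \<Longrightarrow> f X \<in> \<Omega>"
    and period: "X \<in> \<Omega> \<Longrightarrow> (f ^^ m) X = X"
    and period_pos: "m > 0"
begin

definition base :: "'x \<Rightarrow> 'x" where
  "base X = (SOME Y. Y \<in> orbit f X)"

definition pos :: "'x \<Rightarrow> nat" where
  "pos X = funpow_dist f (base X) X"

definition len :: "'x \<Rightarrow> nat" where
  "len X = card (orbit f X)"

text \<open>On a cycle of length \<open>k\<close> the exponents \<open>r m/k\<close> with \<open>r < k\<close> are the orders of vanishing of the
  \<open>k\<close> eigenfunctions. The position in the cycle serves to label the eigenfunctions, by as many indices
  as there are cosets in the cycle.\<close>

definition weight :: "'x \<Rightarrow> nat" where
  "weight X = m div len X * pos X"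

lemma self_in: "X \<in> \<Omega> \<Longrightarrow> X \<in> orbit f X"
proof -
  assume "X \<in> \<Omega>"
  then have "X = (f ^^ m) X" by (rule period[symmetric])
  then show ?thesis unfolding orbit_altdef using period_pos by blast
qed

lemma orbit_in: "X \<in> \<Omega> \<Longrightarrow> orbit f X \<subseteq> \<Omega>"
proof
  fix Y assume X: "X \<in> \<Omega>"
  show "Y \<in> orbit f X \<Longrightarrow> Y \<in> \<Omega>" by (induction rule: orbit.induct) (auto intro: closed X)
qed

lemma orbit_eq: "X \<in> \<Omega> \<Longrightarrow> Y \<in> orbit f X \<Longrightarrow> orbit f Y = orbit f X"
  by (meson orbit_swap orbit_trans self_in subsetI subset_antisym)

lemma base_in_orbit: "base X \<in> orbit f X"
  unfolding base_def by (rule someI[of _ "f X"]) (rule orbit.base)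

lemma base_in: "X \<in> \<Omega> \<Longrightarrow> base X \<in> \<Omega>"
  using base_in_orbit orbit_in by blast

lemma orbit_base: "X \<in> \<Omega> \<Longrightarrow> orbit f (base X) = orbit f X"
  using base_in_orbit orbit_eq by blast

lemma base_eq: "orbit f X = orbit f Y \<Longrightarrow> base X = base Y"
  by (simp add: base_def)

lemma len_dvd: "X \<in> \<Omega> \<Longrightarrow> len X dvd m"
  unfolding len_def by (rule card_orbit_dvd[OF period period_pos])

lemma len_pos: "X \<in> \<Omega> \<Longrightarrow> len X > 0"
  using len_dvd period_pos by (metis dvd_0_left_iff gr0I)

lemma len_eq: "X \<in> \<Omega> \<Longrightarrow> len X = funpow_dist1 f (base X) (base X)"
proof -
  assume X: "X \<in> \<Omega>"
  have b: "base X \<in> orbit f (base X)" using base_in[OF X] by (rule self_in)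
  show ?thesis
    unfolding len_def orbit_base[OF X, symmetric]
    by (subst orbit_conv_funpow_dist1[OF b])
      (simp only: card_image[OF inj_on_funpow_dist1[OF b]] card_atLeastLessThan diff_zero)
qed

lemma funpow_len: "X \<in> \<Omega> \<Longrightarrow> (f ^^ len X) (base X) = base X"
  by (subst len_eq, assumption) (rule funpow_dist1_prop, rule self_in, rule base_in)

lemma funpow_pos: "X \<in> \<Omega> \<Longrightarrow> (f ^^ pos X) (base X) = X"
  unfolding pos_def by (rule funpow_dist_prop) (simp add: orbit_base self_in)

lemma inj_funpow: "X \<in> \<Omega> \<Longrightarrow> inj_on (\<lambda>n. (f ^^ n) (base X)) {0..<len X}"
  by (subst len_eq, assumption) (intro inj_on_funpow_dist1 self_in base_in)

lemma orbit_conv: "X \<in> \<Omega> \<Longrightarrow> orbit f X = (\<lambda>n. (f ^^ n) (base X)) ` {0..<len X}"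
  by (subst len_eq, assumption)
    (simp only: orbit_base[symmetric] orbit_conv_funpow_dist1[OF self_in[OF base_in]])

lemma pos_less: "X \<in> \<Omega> \<Longrightarrow> pos X < len X"
proof -
  assume X: "X \<in> \<Omega>"
  then obtain n where "n < len X" "(f ^^ n) (base X) = X"
    using self_in[OF X] unfolding orbit_conv[OF X] by auto
  then show ?thesis unfolding pos_def funpow_dist_def
    using Least_le[of "\<lambda>n. (f ^^ n) (base X) = X" n] by simp
qed

lemma pos_funpow:
  assumes X: "X \<in> \<Omega>" and Y: "(f ^^ s) (base X) = Y"
  shows "pos Y = s mod len X" "orbit f Y = orbit f X"
proof -
  have "Y \<in> orbit f X" using funpow_in_orbit[OF base_in_orbit] Y by blast
  then show o: "orbit f Y = orbit f X" using orbit_eq[OF X] by blast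
  have YO: "Y \<in> \<Omega>" using \<open>Y \<in> orbit f X\<close> orbit_in[OF X] by blast
  have b: "base Y = base X" using o by (rule base_eq)
  have l: "len Y = len X" using o by (simp add: len_def)
  have "(f ^^ (s mod len X)) (base X) = (f ^^ pos Y) (base X)"
    using funpow_pos[OF YO] Y funpow_mod_eq[OF funpow_len[OF X], of s] by (simp add: b)
  moreover have "pos Y < len X" "s mod len X < len X" using pos_less[OF YO] len_pos[OF X] l by simp_all
  ultimately show "pos Y = s mod len X"
    using inj_onD[OF inj_funpow[OF X], of "s mod len X" "pos Y"] by simp
qed

lemma pos_bij: "X \<in> \<Omega> \<Longrightarrow> bij_betw pos (orbit f X) {0..<len X}"
proof (rule bij_betw_byWitness[where f' = "\<lambda>n. (f ^^ n) (base X)"])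
  assume X: "X \<in> \<Omega>"
  show "\<forall>Y\<in>orbit f X. (f ^^ pos Y) (base X) = Y"
  proof
    fix Y assume Y: "Y \<in> orbit f X"
    have "base Y = base X" using orbit_eq[OF X Y] by (rule base_eq)
    moreover have "Y \<in> \<Omega>" using Y orbit_in[OF X] by blast
    ultimately show "(f ^^ pos Y) (base X) = Y" using funpow_pos[of Y] by simp
  qed
  show "\<forall>n\<in>{0..<len X}. pos ((f ^^ n) (base X)) = n"
    using pos_funpow(1)[OF X refl] by simp
  show "pos ` orbit f X \<subseteq> {0..<len X}"
  proof
    fix n assume "n \<in> pos ` orbit f X"
    then obtain Y where Y: "Y \<in> orbit f X" "n = pos Y" by blast
    have "len Y = len X" using orbit_eq[OF X Y(1)] by (simp add: len_def)
    moreover have "Y \<in> \<Omega>" using Y(1) orbit_in[OF X] by blast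
    ultimately show "n \<in> {0..<len X}" using pos_less[of Y] Y(2) by simp
  qed
  show "(\<lambda>n. (f ^^ n) (base X)) ` {0..<len X} \<subseteq> orbit f X"
    using orbit_conv[OF X] by simp
qed

lemma weight_less: "X \<in> \<Omega> \<Longrightarrow> weight X < m"
proof -
  assume X: "X \<in> \<Omega>"
  then obtain c where m: "m = len X * c" using len_dvd by blast
  then have "m div len X = c" using len_pos[OF X] by (metis nonzero_mult_div_cancel_left not_gr0)
  then have "weight X = c * pos X" unfolding weight_def by (rule arg_cong)
  moreover have "c > 0" using m period_pos by (cases c) auto
  ultimately show ?thesis using m pos_less[OF X] by (simp add: mult.commute)
qed

lemma len_mult_weight: "X \<in> \<Omega> \<Longrightarrow> len X * weight X = m * pos X"
  using len_dvd[of X] by (auto simp: weight_def)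

lemma weight_inj:
  assumes "X \<in> \<Omega>" "Y \<in> \<Omega>" "orbit f X = orbit f Y" "weight X = weight Y"
  shows "X = Y"
proof -
  have "len X = len Y" using assms by (simp add: len_def)
  then have "m * pos X = m * pos Y" using len_mult_weight assms by metis
  then have pos: "pos X = pos Y" using period_pos by simp
  have "X = (f ^^ pos X) (base X)" by (rule funpow_pos[OF assms(1), symmetric])
  also have "\<dots> = (f ^^ pos Y) (base Y)" by (simp only: pos base_eq[OF assms(3)])
  also have "\<dots> = Y" by (rule funpow_pos[OF assms(2)])
  finally show ?thesis .
qed

text \<open>The exponents modulo \<open>m\<close> that can occur in the transversal expansion of a function attached to
  \<open>X\<close>, which is invariant under the \<open>len X\<close>-th power of the generator, are the weights of the
  cycle of \<open>X\<close>.\<close>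

lemma weight_witness:
  assumes X: "X \<in> \<Omega>" and n: "m dvd len X * n"
  obtains Y where "Y \<in> \<Omega>" "orbit f Y = orbit f X" "weight Y = n mod m"
proof -
  obtain c where c: "m = len X * c" using len_dvd[OF X] by blast
  have lp: "len X > 0" using len_pos[OF X] .
  have cp: "c > 0" using c period_pos by (cases c) auto
  have "c dvd n" using n lp unfolding c by simp
  then obtain k where k: "n = c * k" by blast
  have nm: "n mod m = c * (k mod len X)" unfolding k c by (simp add: mult.commute)
  define Y where "Y = (f ^^ (k mod len X)) (base X)"
  note Y = pos_funpow[OF X Y_def[symmetric]]
  have "len Y = len X" using Y(2) by (simp add: len_def)
  moreover have "m div len X = c" using c lp by (metis nonzero_mult_div_cancel_left not_gr0)
  ultimately have "weight Y = n mod m" using Y(1) unfolding weight_def nm by simp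
  moreover have "Y \<in> \<Omega>" using funpow_in_orbit[OF base_in_orbit] orbit_in[OF X] unfolding Y_def by blast
  ultimately show thesis using that Y(2) by blast
qed


text \<open>A cycle of length \<open>k\<close> contributes \<open>2 (m/k) (0 + 1 + \<dots> + (k - 1)) = m (k - 1)\<close>; fixed points
  contribute nothing, so the sum may start at length two.\<close>

lemma sum_weight:
  "2 * (\<Sum>X\<in>\<Omega>. weight X) =
     (\<Sum>i = 2..card \<Omega>. m * card {Z \<in> orbit f ` \<Omega>. card Z = i} * (i - 1))"
proof -
  have fin: "finite (orbit f ` \<Omega>)" using finite_domain by simp
  have orb: "2 * (\<Sum>X\<in>Z. weight X) = m * (card Z - 1)" if Z: "Z \<in> orbit f ` \<Omega>" for Z
  proof -
    obtain X where X: "X \<in> \<Omega>" "Z = orbit f X" using Z by blast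
    obtain c where c: "m = len X * c" using len_dvd[OF X(1)] by blast
    have "(\<Sum>Y\<in>Z. weight Y) = (\<Sum>Y\<in>Z. c * pos Y)"
    proof (rule sum.cong)
      fix Y assume "Y \<in> Z"
      then have "len Y = len X" using orbit_eq X by (simp add: len_def)
      moreover have "m div len X = c" using c len_pos[OF X(1)] by (metis nonzero_mult_div_cancel_left not_gr0)
      ultimately show "weight Y = c * pos Y" unfolding weight_def by simp
    qed simp
    also have "\<dots> = (\<Sum>n\<in>{0..<len X}. c * n)"
      unfolding X(2) by (rule sum.reindex_bij_betw[OF pos_bij[OF X(1)]])
    also have "2 * \<dots> = c * (2 * (\<Sum>n\<in>{0..<len X}. n))" by (simp add: sum_distrib_left mult.left_commute)
    also have "2 * (\<Sum>n\<in>{0..<len X}. n) = len X * (len X - 1)"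
    proof (cases "len X")
      case (Suc n)
      have "2 * \<Sum>{0..n} = n * Suc n" using gauss_sum_nat[of n] by simp
      then show ?thesis using Suc by (simp add: atLeastLessThanSuc_atLeastAtMost mult.commute)
    qed simp
    finally show ?thesis using c X by (simp add: len_def)
  qed
  have "(\<Sum>X\<in>\<Omega>. weight X) = (\<Sum>Z\<in>orbit f ` \<Omega>. \<Sum>X\<in>{X \<in> \<Omega>. orbit f X = Z}. weight X)"
    by (rule sum.image_gen[OF finite_domain])
  also have "\<dots> = (\<Sum>Z\<in>orbit f ` \<Omega>. \<Sum>X\<in>Z. weight X)"
  proof (rule sum.cong[OF refl])
    fix Z assume "Z \<in> orbit f ` \<Omega>"
    then have "{X \<in> \<Omega>. orbit f X = Z} = Z" using orbit_eq orbit_in self_in by blast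
    then show "(\<Sum>X\<in>{X \<in> \<Omega>. orbit f X = Z}. weight X) = (\<Sum>X\<in>Z. weight X)" by simp
  qed
  finally have "2 * (\<Sum>X\<in>\<Omega>. weight X) = (\<Sum>Z\<in>orbit f ` \<Omega>. 2 * (\<Sum>X\<in>Z. weight X))"
    by (simp only: sum_distrib_left)
  also have "\<dots> = (\<Sum>Z\<in>orbit f ` \<Omega>. m * (card Z - 1))"
    by (rule sum.cong[OF refl orb])
  also have "\<dots> = (\<Sum>Z\<in>{Z \<in> orbit f ` \<Omega>. card Z \<in> {2..card \<Omega>}}. m * (card Z - 1))"
  proof (rule sum.mono_neutral_right[OF fin])
    show "\<forall>Z\<in>orbit f ` \<Omega> - {Z \<in> orbit f ` \<Omega>. card Z \<in> {2..card \<Omega>}}. m * (card Z - 1) = 0"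
    proof
      fix Z assume Z: "Z \<in> orbit f ` \<Omega> - {Z \<in> orbit f ` \<Omega>. card Z \<in> {2..card \<Omega>}}"
      then have "card Z \<le> card \<Omega>" using orbit_in finite_domain by (auto intro!: card_mono)
      then have "card Z \<le> 1" using Z by auto
      then show "m * (card Z - 1) = 0" by simp
    qed
  qed auto
  also have "\<dots> = (\<Sum>i = 2..card \<Omega>. \<Sum>Z\<in>{Z \<in> {Z \<in> orbit f ` \<Omega>. card Z \<in> {2..card \<Omega>}}. card Z = i}. m * (card Z - 1))"
    using fin by (intro sum.group[symmetric]) auto
  also have "\<dots> = (\<Sum>i = 2..card \<Omega>. m * card {Z \<in> orbit f ` \<Omega>. card Z = i} * (i - 1))"
  proof (rule sum.cong[OF refl])
    fix i assume "i \<in> {2..card \<Omega>}"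
    then have "{Z \<in> {Z \<in> orbit f ` \<Omega>. card Z \<in> {2..card \<Omega>}}. card Z = i} = {Z \<in> orbit f ` \<Omega>. card Z = i}"
      by auto
    then show "(\<Sum>Z\<in>{Z \<in> {Z \<in> orbit f ` \<Omega>. card Z \<in> {2..card \<Omega>}}. card Z = i}. m * (card Z - 1))
       = m * card {Z \<in> orbit f ` \<Omega>. card Z = i} * (i - 1)"
      by simp
  qed
  finally show ?thesis .
qed

end

text \<open>The cosets are numbered by the index type of the secondaries, in order that the Fourier matrix
  can be multiplied with the matrix of secondaries.\<close>

locale fourier_frame = periodic_map f \<Omega> m for f :: "'x \<Rightarrow> 'x" and \<Omega> :: "'x set" and m :: nat +
  fixes \<phi> :: "'l::finite \<Rightarrow> 'x" and \<zeta> :: complex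
  assumes bij: "bij_betw \<phi> UNIV \<Omega>"
    and primitive: "\<zeta> ^ j = 1 \<longleftrightarrow> m dvd j"
begin

lemma \<phi>_in [simp]: "\<phi> i \<in> \<Omega>"
  using bij by (auto simp: bij_betw_def)

lemma \<zeta>_nz: "\<zeta> \<noteq> 0"
  using primitive[of m] period_pos by (auto simp: power_0_left)

text \<open>The discrete Fourier transforms of all cycles in one block matrix: row \<open>i\<close> is a coset, column \<open>j\<close>
  the eigenfunction labelled by the position of \<open>\<phi> j\<close>.\<close>

definition fourier :: "complex^'l^'l" where
  "fourier = (\<chi> i j. if orbit f (\<phi> i) = orbit f (\<phi> j) then inverse \<zeta> ^ (pos (\<phi> i) * weight (\<phi> j)) else 0)"

lemma geometric_sum_root:
  fixes x :: complex
  assumes "x ^ n = 1" "x \<noteq> 1"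
  shows "(\<Sum>a\<in>{0..<n}. x ^ a) = 0"
  using assms geometric_sum[of x n] by (simp add: atLeast0LessThan)

lemma root_power_eq_iff:
  assumes "a < m" "b < m"
  shows "\<zeta> ^ a * inverse \<zeta> ^ b = 1 \<longleftrightarrow> a = b"
proof -
  have "a = b" if "\<zeta> ^ a = \<zeta> ^ b" "a < m" "b < m" "a \<le> b" for a b
  proof -
    have "\<zeta> ^ b = \<zeta> ^ a * \<zeta> ^ (b - a)" using that(4) power_add[of \<zeta> a "b - a"] by simp
    then have "\<zeta> ^ (b - a) = 1" using that \<zeta>_nz by simp
    then have "m dvd b - a" by (simp add: primitive)
    then show ?thesis using that dvd_imp_le[of m "b - a"] by linarith
  qed
  then have "\<zeta> ^ a = \<zeta> ^ b \<longleftrightarrow> a = b" using assms by (metis nat_le_linear)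
  moreover have "\<zeta> ^ a * inverse \<zeta> ^ b = 1 \<longleftrightarrow> \<zeta> ^ a = \<zeta> ^ b"
    using \<zeta>_nz by (simp add: field_simps)
  ultimately show ?thesis by blast
qed

text \<open>By orthogonality of the characters of a cyclic group, the conjugate transpose of the matrix times
  the matrix is diagonal with the cycle lengths as entries.\<close>

lemma det_fourier: "det fourier \<noteq> 0"
proof -
  define U :: "complex^'l^'l" where
    "U = (\<chi> j i. if orbit f (\<phi> i) = orbit f (\<phi> j) then \<zeta> ^ (pos (\<phi> i) * weight (\<phi> j)) else 0)"
  have entry: "(U ** fourier) $ j $ j' = (if j = j' then of_nat (len (\<phi> j)) else 0)" for j j'
  proof (cases "orbit f (\<phi> j) = orbit f (\<phi> j')")
    case False
    then have "(U ** fourier) $ j $ j' = (\<Sum>i\<in>UNIV. 0)"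
      unfolding matrix_matrix_mult_def U_def fourier_def by (simp, intro sum.neutral) auto
    then show ?thesis using False by auto
  next
    case True
    define x where "x = \<zeta> ^ weight (\<phi> j) * inverse \<zeta> ^ weight (\<phi> j')"
    have "U $ j $ i * fourier $ i $ j' = (if \<phi> i \<in> orbit f (\<phi> j) then x ^ pos (\<phi> i) else 0)" for i
    proof -
      have "\<phi> i \<in> orbit f (\<phi> j) \<longleftrightarrow> orbit f (\<phi> i) = orbit f (\<phi> j)"
        using orbit_eq self_in \<phi>_in by metis
      then show ?thesis
        using True by (simp add: U_def fourier_def x_def power_mult_distrib power_mult[symmetric] mult.commute)
    qed
    then have "(U ** fourier) $ j $ j' = (\<Sum>i\<in>UNIV. if \<phi> i \<in> orbit f (\<phi> j) then x ^ pos (\<phi> i) else 0)"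
      by (simp add: matrix_matrix_mult_def)
    also have "\<dots> = (\<Sum>X\<in>\<Omega>. if X \<in> orbit f (\<phi> j) then x ^ pos X else 0)"
      by (rule sum.reindex_bij_betw[OF bij])
    also have "\<dots> = (\<Sum>X\<in>orbit f (\<phi> j). x ^ pos X)"
      using orbit_in[OF \<phi>_in, of j] finite_domain by (simp add: sum.inter_restrict[symmetric] Int_absorb1)
    also have "\<dots> = (\<Sum>a\<in>{0..<len (\<phi> j)}. x ^ a)"
      by (rule sum.reindex_bij_betw[OF pos_bij[OF \<phi>_in]])
    finally have S: "(U ** fourier) $ j $ j' = (\<Sum>a\<in>{0..<len (\<phi> j)}. x ^ a)" .
    have x1: "x = 1 \<longleftrightarrow> j = j'"
      using root_power_eq_iff[OF weight_less weight_less, OF \<phi>_in \<phi>_in, of j j'] weight_inj[OF \<phi>_in \<phi>_in True]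
        bij_betw_imp_inj_on[OF bij] by (auto simp: x_def inj_eq)
    have l: "len (\<phi> j') = len (\<phi> j)" using True by (simp add: len_def)
    have one: "\<zeta> ^ (weight (\<phi> i) * len (\<phi> i)) = 1" for i
      using len_mult_weight[OF \<phi>_in, of i] by (simp add: primitive mult.commute)
    have "x ^ len (\<phi> j) = 1"
      using one[of j] one[of j'] by (simp add: x_def power_mult_distrib power_inverse l flip: power_mult)
    then show ?thesis using S x1 geometric_sum_root[of x "len (\<phi> j)"] by auto
  qed
  have "det (U ** fourier) = (\<Prod>j\<in>UNIV. of_nat (len (\<phi> j)))"
    by (subst det_diagonal) (simp_all add: entry)
  moreover have "(\<Prod>j\<in>UNIV. of_nat (len (\<phi> j))) \<noteq> (0::complex)"
    using len_pos[OF \<phi>_in] by (simp add: neq0_conv)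
  ultimately show ?thesis by (metis det_mul mult_zero_right)
qed

end

section \<open>Matrix groups, averaging and invariants\<close>

definition matrix_group :: "(complex^'n::finite^'n) set \<Rightarrow> bool" where
  "matrix_group S \<longleftrightarrow> finite S \<and> mat 1 \<in> S \<and> (\<forall>a\<in>S. \<forall>b\<in>S. a ** b \<in> S) \<and>
     (\<forall>a\<in>S. invertible a \<and> matrix_inv a \<in> S)"

lemma matrix_inv_mult:
  fixes a :: "complex^'n::finite^'n"
  assumes "invertible a"
  shows "a ** matrix_inv a = mat 1" "matrix_inv a ** a = mat 1"
  using someI_ex[of "\<lambda>b. a ** b = mat 1 \<and> b ** a = mat 1"] assms
  unfolding matrix_inv_def invertible_def by auto

lemma matrix_inv_eqI:
  fixes a b :: "complex^'n::finite^'n"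
  assumes "a ** b = mat 1" "b ** a = mat 1"
  shows "matrix_inv a = b"
proof -
  have "invertible a" using assms unfolding invertible_def by blast
  note i = matrix_inv_mult[OF this]
  have "matrix_inv a = matrix_inv a ** (a ** b)" using assms by simp
  also have "\<dots> = b" by (simp add: matrix_mul_assoc i)
  finally show ?thesis .
qed

lemma matrix_group_memD:
  assumes "matrix_group S" "a \<in> S"
  shows "invertible a" "matrix_inv a \<in> S"
    "a ** matrix_inv a = mat 1" "matrix_inv a ** a = mat 1"
    "a *v (matrix_inv a *v x) = x" "matrix_inv a *v (a *v x) = x"
    "b \<in> S \<Longrightarrow> a ** b \<in> S"
    "b \<in> S \<Longrightarrow> matrix_inv (a ** b) = matrix_inv b ** matrix_inv a"
proof -
  show i: "invertible a" and "matrix_inv a \<in> S" and "b \<in> S \<Longrightarrow> a ** b \<in> S"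
    using assms unfolding matrix_group_def by auto
  note ia = matrix_inv_mult[OF i]
  show "a ** matrix_inv a = mat 1" "matrix_inv a ** a = mat 1"
    "a *v (matrix_inv a *v x) = x" "matrix_inv a *v (a *v x) = x"
    using ia by (simp_all add: matrix_vector_mul_assoc)
  assume "b \<in> S"
  then have "invertible b" using assms unfolding matrix_group_def by auto
  note ib = matrix_inv_mult[OF this]
  show "matrix_inv (a ** b) = matrix_inv b ** matrix_inv a"
  proof (rule matrix_inv_eqI)
    have "a ** b ** (matrix_inv b ** matrix_inv a) = a ** (b ** matrix_inv b) ** matrix_inv a"
      by (simp only: matrix_mul_assoc)
    then show "a ** b ** (matrix_inv b ** matrix_inv a) = mat 1" by (simp add: ib ia)
    have "matrix_inv b ** matrix_inv a ** (a ** b) = matrix_inv b ** (matrix_inv a ** a) ** b"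
      by (simp only: matrix_mul_assoc)
    then show "matrix_inv b ** matrix_inv a ** (a ** b) = mat 1" by (simp add: ib ia)
  qed
qed

definition lcoset :: "complex^'n::finite^'n \<Rightarrow> (complex^'n^'n) set \<Rightarrow> (complex^'n^'n) set" where
  "lcoset a G = (**) a ` G"

lemma lcoset_eq:
  assumes S: "matrix_group S" and G: "matrix_group G" "G \<subseteq> S" and a: "a \<in> S" and b: "b \<in> lcoset a G"
  shows "lcoset b G = lcoset a G"
proof -
  obtain h where h: "h \<in> G" "b = a ** h" using b by (auto simp: lcoset_def)
  have "(**) h ` G = G"
  proof
    show "(**) h ` G \<subseteq> G" using matrix_group_memD(7)[OF G(1) h(1)] by auto
    show "G \<subseteq> (**) h ` G"
    proof
      fix x assume x: "x \<in> G"
      have "x = h ** (matrix_inv h ** x)"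
        by (simp add: matrix_mul_assoc matrix_group_memD(3)[OF G(1) h(1)])
      then show "x \<in> (**) h ` G"
        using matrix_group_memD(7)[OF G(1) matrix_group_memD(2)[OF G(1) h(1)] x] by blast
    qed
  qed
  then have "(**) a ` ((**) h ` G) = (**) a ` G" by simp
  then show ?thesis unfolding lcoset_def h(2) image_image by (simp add: matrix_mul_assoc)
qed

lemma self_in_lcoset: "matrix_group G \<Longrightarrow> a \<in> lcoset a G"
  unfolding lcoset_def matrix_group_def by (auto intro!: image_eqI[of _ _ "mat 1"])

lemma lcoset_subset: "matrix_group S \<Longrightarrow> G \<subseteq> S \<Longrightarrow> a \<in> S \<Longrightarrow> lcoset a G \<subseteq> S"
  using matrix_group_memD(7) unfolding lcoset_def by blast

lemma inj_matrix_mult: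
  assumes "matrix_group S" "a \<in> S"
  shows "inj ((**) a :: _ \<Rightarrow> complex^'n::finite^'n)"
proof (rule injI)
  fix x y :: "complex^'n^'n" assume "a ** x = a ** y"
  then have "matrix_inv a ** a ** x = matrix_inv a ** a ** y" by (simp only: matrix_mul_assoc[symmetric])
  then show "x = y" by (simp add: matrix_group_memD(4)[OF assms])
qed

text \<open>The sum over \<open>G\<close> rather than the mean: invariance is all that matters, and the multiplicities
  that arise are nonzero.\<close>

definition reynolds :: "(complex^'n::finite^'n) set \<Rightarrow> 'n mpoly \<Rightarrow> 'n mpoly" where
  "reynolds G q = (\<Sum>h\<in>G. act h q)"

lemma poly_eval_act_reynolds:
  assumes S: "matrix_group S" and G: "G \<subseteq> S" and a: "a \<in> S"
  shows "poly_eval (act a (reynolds G q)) v = (\<Sum>b\<in>lcoset a G. poly_eval q (matrix_inv b *v v))"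
proof -
  have "(\<Sum>b\<in>lcoset a G. poly_eval q (matrix_inv b *v v)) = (\<Sum>h\<in>G. poly_eval q (matrix_inv (a ** h) *v v))"
    unfolding lcoset_def using inj_matrix_mult[OF S a]
    by (subst sum.reindex) (auto intro: inj_on_subset)
  also have "\<dots> = (\<Sum>h\<in>G. poly_eval q (matrix_inv h *v (matrix_inv a *v v)))"
    using G by (intro sum.cong refl) (auto simp: matrix_group_memD(8)[OF S a] matrix_vector_mul_assoc)
  finally show ?thesis by (simp add: reynolds_def poly_eval_act poly_eval_sum)
qed

lemma act_eq_of_lcoset_eq:
  assumes S: "matrix_group S" and G: "G \<subseteq> S" and a: "a \<in> S" and b: "b \<in> lcoset a G"
    and inv: "\<And>h. h \<in> G \<Longrightarrow> act h f = f"
  shows "act b f = act a f"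
proof (rule poly_eval_inject)
  fix v
  obtain h where h: "h \<in> G" "b = a ** h" using b by (auto simp: lcoset_def)
  have "poly_eval (act b f) v = poly_eval (act h f) (matrix_inv a *v v)"
    using h G by (auto simp: poly_eval_act matrix_group_memD(8)[OF S a] matrix_vector_mul_assoc)
  then show "poly_eval (act b f) v = poly_eval (act a f) v"
    using inv[OF h(1)] by (simp add: poly_eval_act)
qed

lemma act_reynolds:
  assumes G: "matrix_group G" and h: "h \<in> G"
  shows "act h (reynolds G q) = reynolds G q"
proof (rule poly_eval_inject)
  fix v
  have one: "mat 1 \<in> G" using G by (simp add: matrix_group_def)
  have "h \<in> lcoset (mat 1) G" using h by (simp add: lcoset_def)
  then have "lcoset h G = lcoset (mat 1) G" by (rule lcoset_eq[OF G G subset_refl one])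
  also have "\<dots> = G" by (simp add: lcoset_def)
  finally have "poly_eval (act h (reynolds G q)) v = (\<Sum>b\<in>G. poly_eval q (matrix_inv b *v v))"
    using poly_eval_act_reynolds[OF G subset_refl h, of q v] by simp
  then show "poly_eval (act h (reynolds G q)) v = poly_eval (reynolds G q) v"
    by (simp add: reynolds_def poly_eval_sum poly_eval_act)
qed

lemma number_field_closed:
  assumes "number_field K"
  shows "0 \<in> K" "1 \<in> K" "x \<in> K \<Longrightarrow> y \<in> K \<Longrightarrow> x + y \<in> K" "x \<in> K \<Longrightarrow> y \<in> K \<Longrightarrow> x * y \<in> K"
    "x \<in> K \<Longrightarrow> - x \<in> K" "x \<in> K \<Longrightarrow> inverse x \<in> K"
  using assms unfolding number_field_def by auto

lemma number_field_sum: "number_field K \<Longrightarrow> (\<And>x. x \<in> A \<Longrightarrow> f x \<in> K) \<Longrightarrow> sum f A \<in> K"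
  by (induction A rule: infinite_finite_induct) (auto simp: number_field_closed)

lemma number_field_prod: "number_field K \<Longrightarrow> (\<And>x. x \<in> A \<Longrightarrow> f x \<in> K) \<Longrightarrow> prod f A \<in> K"
  by (induction A rule: infinite_finite_induct) (auto simp: number_field_closed)

lemma number_field_power: "number_field K \<Longrightarrow> x \<in> K \<Longrightarrow> x ^ n \<in> K"
  by (induction n) (auto simp: number_field_closed)

lemma poly_mapping_sum_singles:
  "f = (\<Sum>m\<in>Poly_Mapping.keys f. Poly_Mapping.single m (Poly_Mapping.lookup f m))" for f :: "'n mpoly"
  by (rule poly_mapping_eqI) (simp add: lookup_sum lookup_single when_def in_keys_iff)

lemma polys_single: "number_field K \<Longrightarrow> c \<in> K \<Longrightarrow> Poly_Mapping.single m c \<in> polys K"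
  by (simp add: polys_def lookup_single when_def number_field_closed)

lemma polys_sum: "number_field K \<Longrightarrow> (\<And>x. x \<in> A \<Longrightarrow> f x \<in> polys K) \<Longrightarrow> sum f A \<in> polys K"
  by (simp add: polys_def lookup_sum number_field_sum)

lemma polys_mult:
  fixes f g :: "'n mpoly"
  assumes K: "number_field K" and "f \<in> polys K" "g \<in> polys K"
  shows "f * g \<in> polys K"
proof -
  have "f * g = (\<Sum>m\<in>Poly_Mapping.keys f. \<Sum>k\<in>Poly_Mapping.keys g.
      Poly_Mapping.single (m + k) (Poly_Mapping.lookup f m * Poly_Mapping.lookup g k))"
    by (subst poly_mapping_sum_singles[of f], subst poly_mapping_sum_singles[of g]) (simp add: sum_product mult_single)
  also have "\<dots> \<in> polys K"
    using assms by (intro polys_sum polys_single number_field_closed) (auto simp: polys_def)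
  finally show ?thesis .
qed

lemma polys_Const: "number_field K \<Longrightarrow> c \<in> K \<Longrightarrow> Const c \<in> polys K"
  by (simp add: Const_def polys_single)

lemma polys_Var: "number_field K \<Longrightarrow> Var i \<in> polys K"
  by (simp add: Var_def polys_single number_field_closed)

lemma polys_one: "number_field K \<Longrightarrow> 1 \<in> polys K"
  using polys_Const[of K 1] number_field_closed(2)[of K] by (simp add: Const_def)

lemma polys_power: "number_field K \<Longrightarrow> f \<in> polys K \<Longrightarrow> f ^ n \<in> polys K"
  by (induction n) (auto simp: polys_one polys_mult)

lemma polys_prod: "number_field K \<Longrightarrow> (\<And>x. x \<in> A \<Longrightarrow> f x \<in> polys K) \<Longrightarrow> prod f A \<in> polys K"
  by (induction A rule: infinite_finite_induct) (auto simp: polys_one polys_mult)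

lemma polys_act:
  assumes K: "number_field K" and "\<And>i j. matrix_inv s $ i $ j \<in> K" and "f \<in> polys K"
  shows "act s f \<in> polys K"
  unfolding act_def poly_subst_def using assms(3)
  by (intro polys_sum polys_mult polys_prod polys_power polys_Const polys_Var K assms) (auto simp: polys_def)

lemma poly_eval_in_field:
  assumes K: "number_field K" and f: "f \<in> polys K" and v: "v \<in> space_over K"
  shows "poly_eval f v \<in> K"
  unfolding poly_eval_def using f v
  by (intro number_field_sum number_field_closed number_field_prod number_field_power K)
    (auto simp: polys_def space_over_def)

text \<open>The secondaries are assumed to generate over \<open>K\<close> only, whereas the points at which orders are
  computed, and so the auxiliary polynomial \<open>q\<close>, are complex. The average of \<open>q\<close> is a complex
  combination of averages of monomials, and those have coefficients in \<open>K\<close>.\<close>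

lemma expand_reynolds:
  fixes \<theta> :: "'l::finite \<Rightarrow> ('n::finite) mpoly"
  assumes K: "number_field K" and S: "matrix_group S" and G: "matrix_group G" "G \<subseteq> S"
    and SK: "\<And>s i j. s \<in> S \<Longrightarrow> s $ i $ j \<in> K"
    and gen: "generates_invariants K S G \<theta> UNIV"
  obtains c where "\<And>j s. s \<in> S \<Longrightarrow> act s (c j) = c j" "reynolds G q = (\<Sum>j\<in>UNIV. c j * \<theta> j)"
proof -
  have "\<exists>c. (\<forall>j\<in>UNIV. c j \<in> invariants K S) \<and> reynolds G (Poly_Mapping.single m 1) = (\<Sum>j\<in>UNIV. c j * \<theta> j)" for m
  proof -
    have "reynolds G (Poly_Mapping.single m 1) \<in> polys K"
      unfolding reynolds_def
      using G matrix_group_memD(2)[OF S] SK number_field_closed[OF K]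
      by (intro polys_sum polys_act polys_single K) auto
    then have "reynolds G (Poly_Mapping.single m 1) \<in> invariants K G"
      using act_reynolds[OF G(1)] by (simp add: invariants_def)
    then show ?thesis using gen unfolding generates_invariants_def by blast
  qed
  then have "\<forall>m. \<exists>c. (\<forall>j\<in>UNIV. c j \<in> invariants K S) \<and> reynolds G (Poly_Mapping.single m 1) = (\<Sum>j\<in>UNIV. c j * \<theta> j)"
    by blast
  from choice[OF this] obtain C where C: "\<And>m j. C m j \<in> invariants K S"
    "\<And>m. reynolds G (Poly_Mapping.single m 1) = (\<Sum>j\<in>UNIV. C m j * \<theta> j)" by blast
  define c where "c j = (\<Sum>m\<in>Poly_Mapping.keys q. Const (Poly_Mapping.lookup q m) * C m j)" for j
  show thesis
  proof
    fix j s assume "s \<in> S"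
    then have "act s (C m j) = C m j" for m using C(1)[of m j] by (simp add: invariants_def)
    then have "poly_eval (C m j) (matrix_inv s *v v) = poly_eval (C m j) v" for m v
      by (metis poly_eval_act)
    then show "act s (c j) = c j"
      by (intro poly_eval_inject) (simp add: poly_eval_act c_def poly_eval_simps)
  next
    show "reynolds G q = (\<Sum>j\<in>UNIV. c j * \<theta> j)"
    proof (rule poly_eval_inject)
      fix v
      have "poly_eval (reynolds G q) v = (\<Sum>h\<in>G. \<Sum>m\<in>Poly_Mapping.keys q. Poly_Mapping.lookup q m *
          poly_eval (act h (Poly_Mapping.single m 1)) v)"
        by (simp add: reynolds_def poly_eval_sum poly_eval_act poly_eval_single poly_eval_def[of q])
      also have "\<dots> = (\<Sum>m\<in>Poly_Mapping.keys q. Poly_Mapping.lookup q m * poly_eval (reynolds G (Poly_Mapping.single m 1)) v)"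
        by (subst sum.swap) (simp add: reynolds_def poly_eval_sum sum_distrib_left)
      also have "\<dots> = (\<Sum>m\<in>Poly_Mapping.keys q. \<Sum>j\<in>UNIV. Poly_Mapping.lookup q m * (poly_eval (C m j) v * poly_eval (\<theta> j) v))"
        by (simp add: C(2) poly_eval_simps sum_distrib_left)
      also have "\<dots> = poly_eval (\<Sum>j\<in>UNIV. c j * \<theta> j) v"
        by (subst sum.swap) (simp add: c_def poly_eval_simps sum_distrib_right mult.assoc)
      finally show "poly_eval (reynolds G q) v = poly_eval (\<Sum>j\<in>UNIV. c j * \<theta> j) v" .
    qed
  qed
qed

section \<open>Jets at points of an orbit\<close>

lemma line_poly_eqs:
  "line_poly (f * g) p w = line_poly f p w * line_poly g p w"
  "line_poly (f - g) p w = line_poly f p w - line_poly g p w"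
  "line_poly (f ^ n) p w = line_poly f p w ^ n"
  "line_poly 1 p w = 1"
  "line_poly (sum F A) p w = (\<Sum>x\<in>A. line_poly (F x) p w)"
  by (rule poly_eqI_all, simp add: poly_line_poly poly_eval_simps poly_sum)+

lemma line_poly_act: "line_poly (act s f) p w = line_poly f (matrix_inv s *v p) (matrix_inv s *v w)"
  by (rule poly_eqI_all)
    (simp add: poly_line_poly poly_eval_act matrix_vector_right_distrib vector_scalar_commute)

definition affine_poly :: "complex^'n \<Rightarrow> complex \<Rightarrow> ('n::finite) mpoly" where
  "affine_poly b c = (\<Sum>k\<in>UNIV. Const (b $ k) * Var k) + Const c"

lemma poly_eval_affine: "poly_eval (affine_poly b c) v = linform b v + c"
  by (simp add: affine_poly_def poly_eval_simps linform_def)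

text \<open>If \<open>u\<close> is \<open>1\<close> at \<open>q\<close> and
  \<open>0\<close> on \<open>T\<close>, then \<open>1 - (1 - u ^ N) ^ N\<close> is a suitable \<open>E\<close>: it is divisible by \<open>u ^ N\<close>, and its
  difference from \<open>1\<close> is an \<open>N\<close>-th power of a polynomial vanishing at \<open>q\<close>.\<close>

lemma jet_separating_poly:
  fixes q :: "complex^'n::finite"
  assumes T: "finite T" "q \<notin> T"
  obtains E where "\<And>r u. r \<in> T \<Longrightarrow> [:0, 1:] ^ N dvd line_poly E r u"
    "\<And>u. [:0, 1:] ^ N dvd line_poly E q u - 1"
proof -
  define ix where "ix r = (SOME i. r $ i \<noteq> q $ i)" for r
  have ix: "r $ ix r \<noteq> q $ ix r" if "r \<in> T" for r
  proof -
    have "r \<noteq> q" using that T by blast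
    then have "\<exists>i. r $ i \<noteq> q $ i" by (simp add: vec_eq_iff)
    then show ?thesis unfolding ix_def by (rule someI_ex)
  qed
  define u where "u = (\<Prod>r\<in>T. Const (inverse (q $ ix r - r $ ix r)) * affine_poly (axis (ix r) 1) (- r $ ix r))"
  have uq: "poly_eval u q = 1"
    unfolding u_def poly_eval_prod using ix by (intro prod.neutral) (force simp: poly_eval_simps poly_eval_affine)
  have ur: "poly_eval u r = 0" if "r \<in> T" for r
    unfolding u_def poly_eval_prod using that T by (auto simp: poly_eval_simps poly_eval_affine intro!: bexI[of _ r])
  have root: "[:0, 1:] dvd x" if "poly x 0 = 0" for x :: "complex poly"
    using that by (simp add: poly_eq_0_iff_dvd)
  show thesis
  proof (rule that[of "1 - (1 - u ^ N) ^ N"])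
    fix r v assume r: "r \<in> T"
    let ?x = "line_poly u r v"
    have "[:0, 1:] dvd ?x" by (rule root) (simp add: poly_line_poly ur[OF r])
    then have "[:0, 1:] ^ N dvd ?x ^ N" by (rule dvd_power_same)
    also have "?x ^ N dvd 1 - (1 - ?x ^ N) ^ N"
      using one_diff_power_eq[of "1 - ?x ^ N" N] by simp
    finally show "[:0, 1:] ^ N dvd line_poly (1 - (1 - u ^ N) ^ N) r v" by (simp add: line_poly_eqs)
  next
    fix v
    let ?x = "line_poly u q v"
    have "[:0, 1:] dvd 1 - ?x ^ N" by (rule root) (simp add: poly_line_poly uq)
    then have "[:0, 1:] ^ N dvd (1 - ?x ^ N) ^ N" by (rule dvd_power_same)
    then show "[:0, 1:] ^ N dvd line_poly (1 - (1 - u ^ N) ^ N) q v - 1" by (simp add: line_poly_eqs)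
  qed
qed

text \<open>Two parameters are needed because a generic direction is not an eigenvector of the
  stabilizer: it is the sum of a fixed vector \<open>y\<close> and a transversal eigenvector \<open>z\<close>.\<close>

definition plane_poly :: "('n::finite) mpoly \<Rightarrow> complex^'n \<Rightarrow> complex^'n \<Rightarrow> complex^'n \<Rightarrow> complex poly poly" where
  "plane_poly f p y z = (\<Sum>m\<in>Poly_Mapping.keys f. Polynomial.smult [:Poly_Mapping.lookup f m:]
     (\<Prod>i\<in>UNIV. [:[:p $ i, y $ i:], [:z $ i:]:] ^ Poly_Mapping.lookup m i))"

lemma poly_plane_poly: "poly (poly (plane_poly f p y z) [:t:]) \<tau> = poly_eval f (p + \<tau> *s y + t *s z)"
  by (simp add: plane_poly_def poly_eval_def poly_sum poly_prod ac_simps)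

lemma plane_expansion:
  fixes f :: "'n::finite mpoly"
  obtains A N where "\<And>\<tau> t. poly_eval f (p + \<tau> *s y + t *s z) = (\<Sum>n<N. poly (A n) \<tau> * t ^ n)"
proof -
  define Q where "Q = plane_poly f p y z"
  have "poly_eval f (p + \<tau> *s y + t *s z) = (\<Sum>n<Suc (Polynomial.degree Q). poly (Polynomial.coeff Q n) \<tau> * t ^ n)" for \<tau> t
    unfolding poly_plane_poly[symmetric] Q_def[symmetric]
    by (simp add: poly_altdef[of Q] poly_sum poly_power lessThan_Suc_atMost)
  then show thesis by (rule that)
qed

section \<open>The order of vanishing at a point with cyclic stabilizer\<close>

definition mpow :: "complex^'n::finite^'n \<Rightarrow> nat \<Rightarrow> complex^'n^'n" where
  "mpow g k = ((**) g ^^ k) (mat 1)"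

lemma mpow_simps: "mpow g 0 = mat 1" "mpow g (Suc k) = g ** mpow g k"
  by (simp_all add: mpow_def)

lemma mpow_in: "matrix_group S \<Longrightarrow> g \<in> S \<Longrightarrow> mpow g k \<in> S"
  by (induction k) (auto simp: mpow_simps matrix_group_def)

lemma funpow_image_lcoset:
  "((\<lambda>X. (**) g ` X) ^^ k) (lcoset a G) = lcoset (mpow g k ** a) G"
  by (induction k) (simp_all add: mpow_simps lcoset_def image_image matrix_mul_assoc)

locale coset_setting =
  fixes K :: "complex set" and S G :: "(complex^'n::finite^'n) set"
    and \<theta> :: "'l::finite \<Rightarrow> 'n mpoly" and \<gamma> :: "'l \<Rightarrow> complex^'n^'n"
  assumes K: "number_field K" and S: "matrix_group S" and G: "matrix_group G" and GS: "G \<subseteq> S"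
    and entries: "\<And>s i j. s \<in> S \<Longrightarrow> s $ i $ j \<in> K"
    and \<theta>_inv: "\<And>h j. h \<in> G \<Longrightarrow> act h (\<theta> j) = \<theta> j"
    and gen: "generates_invariants K S G \<theta> UNIV"
    and \<gamma>_in: "\<And>i. \<gamma> i \<in> S"
    and \<gamma>_bij: "bij_betw (\<lambda>i. lcoset (\<gamma> i) G) UNIV ((\<lambda>a. lcoset a G) ` S)"

text \<open>The stabilizer of \<open>p\<close> is generated by \<open>g\<close> of order \<open>m\<close>. In the nontrivial case \<open>g\<close> is a reflection,
  \<open>a\<close> a linear form of its hyperplane, and \<open>\<zeta>\<close> its primitive \<open>m\<close>-th root of unity as eigenvalue. The
  trivial case is \<open>g = 1\<close>, \<open>\<zeta> = 1\<close>, \<open>m = 1\<close>, \<open>y = 0\<close>, \<open>z = w\<close>, with any form \<open>a\<close> taking the value \<open>1\<close>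
  at \<open>w\<close>.\<close>

locale local_setting = coset_setting K S G \<theta> \<gamma>
  for K :: "complex set" and S G :: "(complex^'n::finite^'n) set"
    and \<theta> :: "'l::finite \<Rightarrow> 'n mpoly" and \<gamma> :: "'l \<Rightarrow> complex^'n^'n" +
  fixes g :: "complex^'n^'n" and \<zeta> :: complex and m :: nat and p w y z a :: "complex^'n"
  assumes g_in: "g \<in> S" and m_pos: "m > 0" and g_period: "mpow g m = mat 1"
    and root: "\<And>j. \<zeta> ^ j = 1 \<longleftrightarrow> m dvd j"
    and stab: "\<And>s. s \<in> S \<Longrightarrow> s *v p = p \<Longrightarrow> \<exists>k. s = mpow g k"
    and g_p: "g *v p = p"
    and a_g: "\<And>x. linform a (g *v x) = \<zeta> * linform a x"
    and a_w: "linform a w = 1"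
    and w_eq: "w = y + z" and g_y: "g *v y = y" and g_z: "g *v z = \<zeta> *s z"

sublocale local_setting \<subseteq> fourier_frame "\<lambda>X. (**) g ` X" "(\<lambda>a. lcoset a G) ` S" m "\<lambda>i. lcoset (\<gamma> i) G" \<zeta>
proof
  show "finite ((\<lambda>a. lcoset a G) ` S)" using S by (simp add: matrix_group_def)
  fix X assume "X \<in> (\<lambda>a. lcoset a G) ` S"
  then obtain b where b: "b \<in> S" "X = lcoset b G" by blast
  have "(**) g ` X = lcoset (g ** b) G"
    unfolding b(2) lcoset_def image_image by (simp add: matrix_mul_assoc)
  then show "(**) g ` X \<in> (\<lambda>a. lcoset a G) ` S"
    using matrix_group_memD(7)[OF S g_in b(1)] by blast
  show "((\<lambda>X. (**) g ` X) ^^ m) X = X"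
    unfolding b(2) funpow_image_lcoset g_period by simp
qed (use m_pos \<gamma>_bij root in auto)

context local_setting
begin

abbreviation "\<phi> i \<equiv> lcoset (\<gamma> i) G"
abbreviation "orb \<equiv> orbit (\<lambda>X. (**) g ` X)"

lemma mpow_in': "mpow g k \<in> S"
  by (rule mpow_in[OF S g_in])

lemma mpow_fixes: "mpow g k *v p = p" "mpow g k *v y = y" "mpow g k *v z = \<zeta> ^ k *s z"
  "linform a (mpow g k *v x) = \<zeta> ^ k * linform a x"
  by (induction k) (simp_all add: mpow_simps matrix_vector_mul_assoc[symmetric] g_p g_y g_z a_g vector_scalar_commute vector_smult_assoc mult.commute)

lemma inv_mpow: "matrix_inv (mpow g k) *v p = p" "matrix_inv (mpow g k) *v y = y"
  "matrix_inv (mpow g k) *v z = inverse \<zeta> ^ k *s z"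
  "linform a (matrix_inv (mpow g k) *v x) = inverse \<zeta> ^ k * linform a x"
proof -
  let ?h = "matrix_inv (mpow g k)"
  note cancel = matrix_group_memD(5,6)[OF S mpow_in']
  show "?h *v p = p" using cancel(2)[of k p] by (simp only: mpow_fixes)
  show "?h *v y = y" using cancel(2)[of k y] by (simp only: mpow_fixes)
  have "z = ?h *v (\<zeta> ^ k *s z)" using cancel(2)[of k z] by (simp only: mpow_fixes)
  then have "z = \<zeta> ^ k *s (?h *v z)" by (simp only: vector_scalar_commute)
  then have "inverse \<zeta> ^ k *s z = inverse \<zeta> ^ k *s (\<zeta> ^ k *s (?h *v z))" by (rule arg_cong)
  then show "?h *v z = inverse \<zeta> ^ k *s z"
    using \<zeta>_nz by (simp add: vector_smult_assoc power_inverse)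
  have "linform a x = \<zeta> ^ k * linform a (?h *v x)"
    using mpow_fixes(4)[of k "?h *v x"] cancel(1)[of k x] by simp
  then show "linform a (?h *v x) = inverse \<zeta> ^ k * linform a x"
    using \<zeta>_nz by (simp add: power_inverse field_simps)
qed

definition rep :: "(complex^'n^'n) set \<Rightarrow> complex^'n^'n" where
  "rep X = (SOME b. b \<in> S \<and> lcoset b G = X)"

lemma rep_base: "rep (base (\<phi> i)) \<in> S" "lcoset (rep (base (\<phi> i))) G = base (\<phi> i)"
proof -
  have "\<exists>b. b \<in> S \<and> lcoset b G = base (\<phi> i)" using base_in[OF \<phi>_in, of i] by blast
  from someI_ex[OF this] show "rep (base (\<phi> i)) \<in> S" "lcoset (rep (base (\<phi> i))) G = base (\<phi> i)"
    unfolding rep_def by auto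
qed

lemma funpow_base: "((\<lambda>X. (**) g ` X) ^^ k) (base (\<phi> i)) = lcoset (mpow g k ** rep (base (\<phi> i))) G"
  using funpow_image_lcoset[of k g "rep (base (\<phi> i))" G] rep_base(2)[of i] by simp

text \<open>In the expansion of \<open>\<gamma>_i f\<close> at \<open>p + \<tau> y + t z\<close> the passage from the base coset of a cycle to the
  coset at position \<open>a\<close> replaces \<open>t\<close> by \<open>\<zeta>\<close> to the power \<open>- a\<close> times \<open>t\<close>. Hence only exponents that are
  weights modulo \<open>m\<close> occur, and collecting the terms by residue class modulo \<open>m\<close> gives the factor
  \<open>B\<close>.\<close>

lemma lower_factor:
  assumes f: "\<And>h. h \<in> G \<Longrightarrow> act h f = f"
  shows "\<exists>B. \<forall>i. line_poly (act (\<gamma> i) f) p w =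
    (\<Sum>j\<in>UNIV. [:fourier $ i $ j:] * Polynomial.monom 1 (weight (\<phi> j)) * B j)"
proof -
  have "\<exists>A N. \<forall>\<tau> t. poly_eval (act (rep b) f) (p + \<tau> *s y + t *s z) = (\<Sum>n<N. poly (A n) \<tau> * t ^ n)" for b
    by (rule plane_expansion[of "act (rep b) f" p y z]) blast
  then obtain A N where AN: "\<And>b \<tau> t. poly_eval (act (rep b) f) (p + \<tau> *s y + t *s z) =
      (\<Sum>n<N b. poly (A b n) \<tau> * t ^ n)"
    by (metis (no_types))
  have shift: "poly_eval (act (mpow g k ** rep b) f) (p + \<tau> *s y + t *s z) =
      (\<Sum>n<N b. poly (A b n) \<tau> * (inverse \<zeta> ^ k * t) ^ n)" if "rep b \<in> S" for b k \<tau> t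
    using AN[of b \<tau> "inverse \<zeta> ^ k * t"]
    by (simp add: poly_eval_act matrix_group_memD(8)[OF S mpow_in' that] matrix_vector_mul_assoc[symmetric]
        matrix_vector_right_distrib vector_scalar_commute inv_mpow vector_smult_assoc mult.commute)
  have rows: "poly_eval (act (\<gamma> i) f) (p + \<tau> *s y + t *s z) =
      (\<Sum>n<N (base (\<phi> i)). poly (A (base (\<phi> i)) n) \<tau> * (inverse \<zeta> ^ pos (\<phi> i) * t) ^ n)" for i \<tau> t
  proof -
    let ?c = "mpow g (pos (\<phi> i)) ** rep (base (\<phi> i))"
    have "\<gamma> i \<in> lcoset ?c G"
      using funpow_pos[OF \<phi>_in, of i] self_in_lcoset[OF G, of "\<gamma> i"] by (simp add: funpow_base)
    then have "act (\<gamma> i) f = act ?c f"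
      by (rule act_eq_of_lcoset_eq[OF S GS matrix_group_memD(7)[OF S mpow_in' rep_base(1)] _ f])
    then show ?thesis using shift[OF rep_base(1)] by simp
  qed
  \<comment> \<open>The \<open>len\<close>-th power of \<open>g\<close> fixes the base coset, so the expansion is invariant under it.\<close>
  have vanish: "m dvd len (\<phi> i) * n" if n: "n < N (base (\<phi> i))" and nz: "A (base (\<phi> i)) n \<noteq> 0" for i n
  proof -
    let ?b = "base (\<phi> i)" and ?k = "len (\<phi> i)"
    have "rep ?b \<in> lcoset (mpow g ?k ** rep ?b) G"
      using funpow_len[OF \<phi>_in, of i] self_in_lcoset[OF G, of "rep ?b"] rep_base(2)[of i] by (simp add: funpow_base)
    then have eq: "act (rep ?b) f = act (mpow g ?k ** rep ?b) f"
      by (rule act_eq_of_lcoset_eq[OF S GS matrix_group_memD(7)[OF S mpow_in' rep_base(1)] _ f])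
    obtain \<tau> where \<tau>: "poly (A ?b n) \<tau> \<noteq> 0" using nz poly_all_0_iff_0 by blast
    define P where "P = (\<Sum>n<N ?b. Polynomial.monom (poly (A ?b n) \<tau> * (1 - (inverse \<zeta> ^ ?k) ^ n)) n)"
    have "poly P t = 0" for t
      using AN[of ?b \<tau> t] shift[OF rep_base(1)[of i], of ?k \<tau> t] eq
      by (simp add: P_def poly_sum poly_monom algebra_simps sum_subtractf power_mult_distrib)
    then have "P = 0" using poly_all_0_iff_0 by blast
    then have "Polynomial.coeff P n = 0" by simp
    moreover have "Polynomial.coeff P n = poly (A ?b n) \<tau> * (1 - (inverse \<zeta> ^ ?k) ^ n)"
      using n by (simp add: P_def Polynomial.coeff_sum)
    ultimately have "(inverse \<zeta> ^ ?k) ^ n = 1" using \<tau> by simp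
    then have "\<zeta> ^ (?k * n) = 1" using \<zeta>_nz by (simp add: power_inverse flip: power_mult)
    then show ?thesis by (simp add: root)
  qed
  \<comment> \<open>In a residue class modulo \<open>m\<close> with representative \<open>r < m\<close> every exponent is at least \<open>r\<close>.\<close>
  define B where "B j = (\<Sum>n<N (base (\<phi> j)). if n mod m = weight (\<phi> j)
      then A (base (\<phi> j)) n * Polynomial.monom 1 (n - weight (\<phi> j)) else 0)" for j
  show ?thesis
  proof (intro exI[of _ B] allI)
    fix i
    let ?b = "base (\<phi> i)" and ?e = "pos (\<phi> i)"
    have inner: "A ?b n * (\<Sum>j\<in>UNIV. if orb (\<phi> j) = orb (\<phi> i) \<and> n mod m = weight (\<phi> j)
          then Polynomial.monom (inverse \<zeta> ^ (?e * weight (\<phi> j))) n else 0)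
        = A ?b n * Polynomial.monom ((inverse \<zeta> ^ ?e) ^ n) n" if n: "n < N ?b" for n
    proof (cases "A ?b n = 0")
      case False
      obtain Y where Y: "Y \<in> (\<lambda>a. lcoset a G) ` S" "orb Y = orb (\<phi> i)" "weight Y = n mod m"
        by (rule weight_witness[OF \<phi>_in vanish[OF n False]])
      then have "Y \<in> range (\<lambda>i. \<phi> i)" using bij_betw_imp_surj_on[OF bij] by simp
      then obtain j0 where j0: "Y = \<phi> j0" by blast
      have uniq: "orb (\<phi> j) = orb (\<phi> i) \<and> n mod m = weight (\<phi> j) \<longleftrightarrow> j = j0" for j
        using weight_inj[OF \<phi>_in \<phi>_in, of j j0] injD[OF bij_betw_imp_inj_on[OF bij], of j j0] Y j0 by auto
      have "inverse \<zeta> ^ (?e * (n mod m)) = (inverse \<zeta> ^ ?e) ^ n"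
      proof -
        have "n = n mod m + m * (n div m)" by simp
        then have "?e * n = ?e * (n mod m + m * (n div m))" by (rule arg_cong)
        also have "\<dots> = ?e * (n mod m) + m * (?e * (n div m))" by (simp only: distrib_left mult.left_commute)
        finally have "inverse \<zeta> ^ (?e * n) = inverse \<zeta> ^ (?e * (n mod m)) * (inverse \<zeta> ^ m) ^ (?e * (n div m))"
          by (simp only: power_add power_mult)
        also have "inverse \<zeta> ^ m = 1" using root[of m] by (simp add: power_inverse)
        finally show ?thesis by (simp add: power_mult)
      qed
      then show ?thesis using Y(3) j0 by (simp add: uniq)
    qed simp
    have "(\<Sum>j\<in>UNIV. [:fourier $ i $ j:] * Polynomial.monom 1 (weight (\<phi> j)) * B j) =
      (\<Sum>j\<in>UNIV. \<Sum>n<N ?b. A ?b n * (if orb (\<phi> j) = orb (\<phi> i) \<and> n mod m = weight (\<phi> j)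
          then Polynomial.monom (inverse \<zeta> ^ (?e * weight (\<phi> j))) n else 0))"
    proof (rule sum.cong[OF refl])
      fix j
      show "[:fourier $ i $ j:] * Polynomial.monom 1 (weight (\<phi> j)) * B j =
        (\<Sum>n<N ?b. A ?b n * (if orb (\<phi> j) = orb (\<phi> i) \<and> n mod m = weight (\<phi> j)
          then Polynomial.monom (inverse \<zeta> ^ (?e * weight (\<phi> j))) n else 0))"
      proof (cases "orb (\<phi> j) = orb (\<phi> i)")
        case False
        then show ?thesis by (auto simp: fourier_def)
      next
        case True
        have fe: "fourier $ i $ j = inverse \<zeta> ^ (?e * weight (\<phi> j))"
          using True by (simp add: fourier_def)
        have "[:c:] * Polynomial.monom 1 r * (if n mod m = r then x * Polynomial.monom 1 (n - r) else 0) =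
            x * (if n mod m = r then Polynomial.monom c n else 0)" for c :: complex and r n x
        proof (cases "n mod m = r")
          case True
          then have "r \<le> n" by auto
          then have "[:c:] * (Polynomial.monom 1 r * Polynomial.monom 1 (n - r)) = Polynomial.monom c n"
            by (simp add: mult_monom smult_monom)
          then show ?thesis using True by (simp add: mult_ac)
        qed simp
        then show ?thesis
          unfolding B_def base_eq[OF True] sum_distrib_left fe using True by simp
      qed
    qed
    also have "\<dots> = (\<Sum>n<N ?b. A ?b n * (\<Sum>j\<in>UNIV. if orb (\<phi> j) = orb (\<phi> i) \<and> n mod m = weight (\<phi> j)
          then Polynomial.monom (inverse \<zeta> ^ (?e * weight (\<phi> j))) n else 0))"
      by (subst sum.swap) (simp only: sum_distrib_left)
    also have "\<dots> = (\<Sum>n<N ?b. A ?b n * Polynomial.monom ((inverse \<zeta> ^ ?e) ^ n) n)"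
      by (intro sum.cong refl inner) simp
    also have "\<dots> = line_poly (act (\<gamma> i) f) p w"
    proof (rule poly_eqI_all)
      fix t
      show "poly (\<Sum>n<N ?b. A ?b n * Polynomial.monom ((inverse \<zeta> ^ ?e) ^ n) n) t = poly (line_poly (act (\<gamma> i) f) p w) t"
        using rows[of i t t]
        by (simp add: poly_line_poly w_eq vector_add_ldistrib add.assoc poly_sum poly_monom power_mult_distrib)
    qed
    finally show "line_poly (act (\<gamma> i) f) p w =
      (\<Sum>j\<in>UNIV. [:fourier $ i $ j:] * Polynomial.monom 1 (weight (\<phi> j)) * B j)" by (rule sym)
  qed
qed

text \<open>Let \<open>\<beta> G\<close> be the base coset of the cycle of \<open>\<phi> j\<close>. The polynomial \<open>q\<close> agrees to order \<open>N\<close> with a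
  power of the transversal linear form, transported by \<open>\<beta>\<close>, at the point \<open>\<beta>\<inverse> p\<close>, and with zero
  at the other points of the orbit. In the average over \<open>G\<close>, seen from the coset \<open>\<phi> i\<close>, only those
  group elements count that bring \<open>p\<close> to this point; they exist only if \<open>\<phi> i\<close> lies in the same cycle,
  and each of them contributes the same entry of the Fourier matrix.\<close>

lemma upper_invariant:
  obtains q where "\<And>i. [:0, 1:] ^ N dvd line_poly (act (\<gamma> i) (reynolds G q)) p w -
    of_nat (card {b \<in> \<phi> i. matrix_inv b *v p = matrix_inv (rep (base (\<phi> j))) *v p}) *
      [:fourier $ i $ j:] * Polynomial.monom 1 (weight (\<phi> j))"
proof -
  define \<beta> where "\<beta> = rep (base (\<phi> j))"
  define r where "r = weight (\<phi> j)"
  define q0 where "q0 = matrix_inv \<beta> *v p"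
  have \<beta>: "\<beta> \<in> S" "lcoset \<beta> G = base (\<phi> j)" using rep_base[of j] by (simp_all add: \<beta>_def)
  let ?T = "(\<lambda>s. matrix_inv s *v p) ` S - {q0}"
  have "finite ?T" "q0 \<notin> ?T" using S by (simp_all add: matrix_group_def)
  then obtain E where E: "\<And>x u. x \<in> ?T \<Longrightarrow> [:0, 1:] ^ N dvd line_poly E x u"
      "\<And>u. [:0, 1:] ^ N dvd line_poly E q0 u - 1"
    by (rule jet_separating_poly[where N = N]) blast
  define l where "l = affine_poly (transpose \<beta> *v a) (- linform a p)"
  have l: "poly_eval l x = linform a (\<beta> *v x - p)" for x
  proof -
    have "linform (transpose \<beta> *v a) x = linform a (\<beta> *v x)"
      unfolding linform_def matrix_vector_mult_def transpose_def
      by (simp add: sum_distrib_left sum_distrib_right, subst sum.swap) (simp add: ac_simps)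
    then show ?thesis by (simp add: l_def poly_eval_affine)
  qed
  define q where "q = l ^ r * E"
  show thesis
  proof (rule that[of q])
    fix i
    let ?C = "{b \<in> \<phi> i. matrix_inv b *v p = q0}"
    let ?F = "[:fourier $ i $ j:] * Polynomial.monom 1 r"
    have fin: "finite (\<phi> i)" using lcoset_subset[OF S GS \<gamma>_in] S unfolding matrix_group_def by (meson finite_subset)
    \<comment> \<open>An element \<open>b\<close> that brings \<open>p\<close> to \<open>q0\<close> differs from \<open>\<beta>\<close> by an element of the stabilizer, hence by a power of \<open>g\<close>.\<close>
    have near: "[:0, 1:] ^ N dvd line_poly (act b q) p w - ?F" if b: "b \<in> ?C" for b
    proof -
      have bS: "b \<in> S" using b lcoset_subset[OF S GS \<gamma>_in] by blast
      note ib = matrix_group_memD[OF S bS] and i\<beta> = matrix_group_memD[OF S \<beta>(1)]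
      have "(b ** matrix_inv \<beta>) *v p = b *v (matrix_inv b *v p)"
        using b by (simp add: q0_def flip: matrix_vector_mul_assoc)
      then have "(b ** matrix_inv \<beta>) *v p = p" by (simp add: ib(5))
      then obtain s where s: "b ** matrix_inv \<beta> = mpow g s" using stab[OF ib(7)[OF i\<beta>(2)]] by blast
      have bs: "b = mpow g s ** \<beta>"
        unfolding s[symmetric] by (simp add: matrix_mul_assoc[symmetric] i\<beta>(4))
      have "lcoset b G = \<phi> i" using lcoset_eq[OF S G GS \<gamma>_in] b by blast
      then have "((\<lambda>X. (**) g ` X) ^^ s) (base (\<phi> j)) = \<phi> i"
        unfolding funpow_base \<beta>_def[symmetric] bs .
      note pf = pos_funpow[OF \<phi>_in this]
      have "inverse \<zeta> ^ (s * r) = inverse \<zeta> ^ (pos (\<phi> i) * r)"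
      proof -
        let ?k = "len (\<phi> j)"
        have "inverse \<zeta> ^ (s * r) = inverse \<zeta> ^ ((s mod ?k + ?k * (s div ?k)) * r)" by simp
        also have "(s mod ?k + ?k * (s div ?k)) * r = s mod ?k * r + m * (pos (\<phi> j) * (s div ?k))"
        proof -
          have "?k * (s div ?k) * r = ?k * weight (\<phi> j) * (s div ?k)" by (simp only: r_def mult_ac)
          then show ?thesis unfolding len_mult_weight[OF \<phi>_in] by (simp only: distrib_right mult.assoc)
        qed
        also have "inverse \<zeta> ^ \<dots> = inverse \<zeta> ^ (s mod ?k * r)"
          using root[of m] by (simp add: power_add power_mult power_inverse)
        finally show ?thesis using pf(1) by simp
      qed
      then have fe: "fourier $ i $ j = inverse \<zeta> ^ (s * r)"
        using pf(2) by (simp add: fourier_def r_def)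
      have lp: "line_poly (act b l) p w = [:0, inverse \<zeta> ^ s:]"
      proof (rule poly_eqI_all)
        fix t
        have "\<beta> *v (matrix_inv b *v x) = matrix_inv (mpow g s) *v x" for x
          unfolding bs matrix_group_memD(8)[OF S mpow_in' \<beta>(1)]
          by (simp add: matrix_vector_mul_assoc[symmetric] i\<beta>(5))
        then have "poly_eval (act b l) (p + t *s w) = t * inverse \<zeta> ^ s"
          by (simp add: poly_eval_act l inv_mpow a_w matrix_vector_right_distrib vector_scalar_commute)
        then show "poly (line_poly (act b l) p w) t = poly [:0, inverse \<zeta> ^ s:] t"
          by (simp add: poly_line_poly)
      qed
      have "line_poly (act b q) p w = [:0, inverse \<zeta> ^ s:] ^ r * line_poly (act b E) p w"
        unfolding lp[symmetric] by (simp add: line_poly_act q_def line_poly_eqs)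
      also have "[:0, inverse \<zeta> ^ s:] ^ r = ?F"
        unfolding fe power_mult by (rule poly_eqI_all) (simp add: poly_monom power_mult_distrib mult.commute)
      finally have eq: "line_poly (act b q) p w - ?F = ?F * (line_poly (act b E) p w - 1)"
        by (simp only: right_diff_distrib mult_1_right)
      have "[:0, 1:] ^ N dvd line_poly (act b E) p w - 1"
        unfolding line_poly_act using E(2) b by simp
      then show ?thesis unfolding eq by (rule dvd_mult)
    qed
    have far: "[:0, 1:] ^ N dvd line_poly (act b q) p w" if b: "b \<in> \<phi> i - ?C" for b
    proof -
      have "matrix_inv b *v p \<in> ?T" using b lcoset_subset[OF S GS \<gamma>_in] by blast
      from E(1)[OF this] show ?thesis by (simp add: line_poly_act q_def line_poly_eqs)
    qed
    have "line_poly (act (\<gamma> i) (reynolds G q)) p w = (\<Sum>b\<in>\<phi> i. line_poly (act b q) p w)"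
      by (rule poly_eqI_all)
        (simp only: poly_line_poly poly_sum poly_eval_act_reynolds[OF S GS \<gamma>_in], simp only: poly_eval_act)
    also have "\<dots> = (\<Sum>b\<in>\<phi> i - ?C. line_poly (act b q) p w) + (\<Sum>b\<in>?C. line_poly (act b q) p w)"
      by (rule sum.subset_diff[OF _ fin]) blast
    finally have split: "line_poly (act (\<gamma> i) (reynolds G q)) p w =
        (\<Sum>b\<in>\<phi> i - ?C. line_poly (act b q) p w) + (\<Sum>b\<in>?C. line_poly (act b q) p w)" .
    have "(\<Sum>b\<in>?C. line_poly (act b q) p w) = (\<Sum>b\<in>?C. line_poly (act b q) p w - ?F) + of_nat (card ?C) * ?F"
      by (simp only: sum_subtractf sum_constant diff_add_cancel)
    then have "line_poly (act (\<gamma> i) (reynolds G q)) p w - of_nat (card ?C) * ?F =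
        (\<Sum>b\<in>\<phi> i - ?C. line_poly (act b q) p w) + (\<Sum>b\<in>?C. line_poly (act b q) p w - ?F)"
      unfolding split by (simp only: add.assoc[symmetric] add_diff_cancel_right')
    moreover have "[:0, 1:] ^ N dvd (\<Sum>b\<in>\<phi> i - ?C. line_poly (act b q) p w) + (\<Sum>b\<in>?C. line_poly (act b q) p w - ?F)"
      by (intro dvd_add dvd_sum near far)
    ultimately show "[:0, 1:] ^ N dvd line_poly (act (\<gamma> i) (reynolds G q)) p w -
       of_nat (card {b \<in> \<phi> i. matrix_inv b *v p = matrix_inv (rep (base (\<phi> j))) *v p}) *
      [:fourier $ i $ j:] * Polynomial.monom 1 (weight (\<phi> j))"
      by (simp only: q0_def \<beta>_def r_def mult.assoc)
  qed
qed

definition line_matrix :: "(complex poly)^'l^'l" where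
  "line_matrix = (\<chi> i j. line_poly (act (\<gamma> i) (\<theta> j)) p w)"

definition local_order :: nat where
  "local_order = (\<Sum>X\<in>(\<lambda>a. lcoset a G) ` S. weight X)"

lemma local_order_eq: "local_order = (\<Sum>j\<in>UNIV. weight (\<phi> j))"
  unfolding local_order_def by (rule sum.reindex_bij_betw[OF bij, symmetric])

definition leading_matrix :: "(complex poly)^'l^'l" where
  "leading_matrix = (\<chi> i j. [:fourier $ i $ j:] * Polynomial.monom 1 (weight (\<phi> j)))"

lemma det_leading_matrix: "det leading_matrix = Polynomial.smult (det fourier) ([:0, 1:] ^ local_order)"
proof -
  have "det leading_matrix = det (\<chi> i j. [:fourier $ i $ j:]) * (\<Prod>j\<in>UNIV. Polynomial.monom 1 (weight (\<phi> j)))"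
    unfolding leading_matrix_def
    using det_scale_columns[of "\<chi> i j. [:fourier $ i $ j:]" "\<lambda>j. Polynomial.monom 1 (weight (\<phi> j))"] by simp
  also have "det (\<chi> i j. [:fourier $ i $ j:]) = [:det fourier:]"
    by (rule det_ring_hom[symmetric]) (simp_all add: one_pCons)
  also have "(\<Prod>j\<in>UNIV. Polynomial.monom 1 (weight (\<phi> j))) = ([:0, 1:] :: complex poly) ^ local_order"
    by (simp add: local_order_eq power_sum monom_altdef)
  finally show ?thesis by simp
qed

lemma line_matrix_lower: "[:0, 1:] ^ local_order dvd det line_matrix"
proof -
  have "\<forall>j. \<exists>B. \<forall>i. line_poly (act (\<gamma> i) (\<theta> j)) p w =
    (\<Sum>k\<in>UNIV. [:fourier $ i $ k:] * Polynomial.monom 1 (weight (\<phi> k)) * B k)"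
    using lower_factor[OF \<theta>_inv] by blast
  from choice[OF this] obtain B where B: "\<And>i j. line_poly (act (\<gamma> i) (\<theta> j)) p w =
    (\<Sum>k\<in>UNIV. [:fourier $ i $ k:] * Polynomial.monom 1 (weight (\<phi> k)) * B j k)" by blast
  have "line_matrix = leading_matrix ** (\<chi> k j. B j k)"
    by (simp add: line_matrix_def leading_matrix_def matrix_matrix_mult_def B vec_eq_iff)
  then show ?thesis by (simp add: det_mul det_leading_matrix dvd_mult2 dvd_smult)
qed

text \<open>Modulo the power of \<open>t\<close> after the expected one, the matrix of the invariants of \<open>upper_invariant\<close>
  is \<open>leading_matrix\<close> with its rows multiplied by positive integers, so its determinant has exactly the
  expected order. It is a multiple of the determinant of the secondaries.\<close>

lemma line_matrix_upper: "\<not> [:0, 1:] ^ Suc local_order dvd det line_matrix"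
proof
  assume dvd: "[:0, 1:] ^ Suc local_order dvd det line_matrix"
  let ?X = "[:0, 1:] ^ Suc local_order :: complex poly"
  define c where "c i j = card {b \<in> \<phi> i. matrix_inv b *v p = matrix_inv (rep (base (\<phi> j))) *v p}" for i j
  have "\<exists>q. \<forall>i. ?X dvd line_poly (act (\<gamma> i) (reynolds G q)) p w -
      of_nat (c i j) * [:fourier $ i $ j:] * Polynomial.monom 1 (weight (\<phi> j))" for j
    unfolding c_def by (rule upper_invariant[where N = "Suc local_order" and j = j]) blast
  then have "\<forall>j. \<exists>q. \<forall>i. ?X dvd line_poly (act (\<gamma> i) (reynolds G q)) p w -
      of_nat (c i j) * [:fourier $ i $ j:] * Polynomial.monom 1 (weight (\<phi> j))" by blast
  from choice[OF this] obtain q where q: "\<And>i j. ?X dvd line_poly (act (\<gamma> i) (reynolds G (q j))) p w -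
      of_nat (c i j) * [:fourier $ i $ j:] * Polynomial.monom 1 (weight (\<phi> j))" by blast
  have "\<exists>C. (\<forall>k s. s \<in> S \<longrightarrow> act s (C k) = C k) \<and> reynolds G (q j) = (\<Sum>k\<in>UNIV. C k * \<theta> k)" for j
    by (rule expand_reynolds[OF K S G GS entries gen, of "q j"]) blast+
  then have "\<forall>j. \<exists>C. (\<forall>k s. s \<in> S \<longrightarrow> act s (C k) = C k) \<and> reynolds G (q j) = (\<Sum>k\<in>UNIV. C k * \<theta> k)" by blast
  from choice[OF this] obtain C where C: "\<And>j k s. s \<in> S \<Longrightarrow> act s (C j k) = C j k"
    "\<And>j. reynolds G (q j) = (\<Sum>k\<in>UNIV. C j k * \<theta> k)" by blast
  define R where "R = (\<chi> i j. line_poly (act (\<gamma> i) (reynolds G (q j))) p w)"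
  have "R = line_matrix ** (\<chi> k j. line_poly (C j k) p w)"
  proof -
    have "line_poly (act (\<gamma> i) (reynolds G (q j))) p w =
        (\<Sum>k\<in>UNIV. line_poly (act (\<gamma> i) (\<theta> k)) p w * line_poly (C j k) p w)" for i j
    proof -
      have "line_poly (act (\<gamma> i) (C j k)) p w = line_poly (C j k) p w" for k using C(1)[OF \<gamma>_in] by simp
      then show ?thesis unfolding C(2) by (simp add: line_poly_act line_poly_eqs mult.commute)
    qed
    then show ?thesis by (simp add: R_def line_matrix_def matrix_matrix_mult_def vec_eq_iff)
  qed
  then have R: "?X dvd det R" using dvd by (simp only: det_mul dvd_mult2)
  \<comment> \<open>Inside a cycle the base coset, and with it the multiplicity, depends on the row only; outside the entry of the Fourier matrix is zero.\<close>
  have same: "of_nat (c i j) * [:fourier $ i $ j:] * Polynomial.monom 1 (weight (\<phi> j)) = of_nat (c i i) * leading_matrix $ i $ j" for i j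
  proof (cases "orb (\<phi> i) = orb (\<phi> j)")
    case True
    then show ?thesis using base_eq[OF True] by (simp add: c_def leading_matrix_def mult.assoc)
  qed (simp add: leading_matrix_def fourier_def)
  have D: "?X dvd det R - det (\<chi> i j. of_nat (c i i) * leading_matrix $ i $ j)"
    by (rule dvd_det_diff) (use q same in \<open>simp add: R_def\<close>)
  have "?X dvd det (\<chi> i j. of_nat (c i i) * leading_matrix $ i $ j)"
    using dvd_diff[OF R D] by (simp only: diff_diff_eq2 add_diff_cancel_left')
  also have "det (\<chi> i j. of_nat (c i i) * leading_matrix $ i $ j) = (\<Prod>i\<in>UNIV. of_nat (c i i)) * det leading_matrix"
    by (rule det_scale_rows)
  also have "\<dots> = Polynomial.smult ((\<Prod>i\<in>UNIV. of_nat (c i i)) * det fourier) ([:0, 1:] ^ local_order)"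
  proof -
    have "(\<Prod>i\<in>UNIV. of_nat (c i i)) = [:\<Prod>i\<in>UNIV. of_nat (c i i) :: complex:]"
      unfolding of_nat_prod[symmetric] by (rule of_nat_poly)
    then show ?thesis by (simp add: det_leading_matrix mult.commute)
  qed
  finally have "?X dvd Polynomial.smult ((\<Prod>i\<in>UNIV. of_nat (c i i)) * det fourier) ([:0, 1:] ^ local_order)" .
  moreover have "(\<Prod>i\<in>UNIV. of_nat (c i i)) * det fourier \<noteq> 0"
  proof -
    have "c i i \<noteq> 0" for i
    proof -
      let ?b = "mpow g (pos (\<phi> i)) ** rep (base (\<phi> i))"
      have "lcoset ?b G = \<phi> i" using funpow_pos[OF \<phi>_in, of i] by (simp add: funpow_base)
      then have "?b \<in> \<phi> i" using self_in_lcoset[OF G, of ?b] by simp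
      moreover have "matrix_inv ?b *v p = matrix_inv (rep (base (\<phi> i))) *v p"
        by (simp add: matrix_group_memD(8)[OF S mpow_in' rep_base(1)] matrix_vector_mul_assoc[symmetric] inv_mpow)
      moreover have "finite (\<phi> i)" using lcoset_subset[OF S GS \<gamma>_in] S unfolding matrix_group_def by (meson finite_subset)
      ultimately show ?thesis unfolding c_def by (subst card_eq_0_iff) auto
    qed
    then show ?thesis using det_fourier by simp
  qed
  ultimately have "?X dvd [:0, 1:] ^ local_order" by (simp add: dvd_smult_iff)
  then have "Polynomial.degree ?X \<le> Polynomial.degree ([:0, 1:] ^ local_order :: complex poly)"
    by (rule dvd_imp_degree_le) simp
  then show False unfolding degree_linear_power by simp
qed

end

section \<open>Univariate polynomials along a line\<close>

lemma line_poly_shift: "pcompose (line_poly f v w) [:t0, 1:] = line_poly f (v + t0 *s w) w"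
  by (rule poly_eqI_all) (simp add: poly_pcompose poly_line_poly vector_sadd_rdistrib add.assoc)

lemma order_pcompose_shift:
  fixes F :: "complex poly"
  assumes "[:0, 1:] ^ n dvd pcompose F [:t0, 1:]" "\<not> [:0, 1:] ^ Suc n dvd pcompose F [:t0, 1:]"
  shows "Polynomial.order t0 F = n"
proof (rule order_unique_lemma)
  have comp: "pcompose (p ^ k) q = pcompose p q ^ k" for p q :: "complex poly" and k
    by (induction k) (simp_all add: pcompose_mult pcompose_1)
  have undo: "pcompose (pcompose F [:t0, 1:]) [:- t0, 1:] = F"
    by (rule poly_eqI_all) (simp add: poly_pcompose)
  obtain Q where "pcompose F [:t0, 1:] = [:0, 1:] ^ n * Q" using assms(1) by blast
  then have "F = pcompose ([:0, 1:] ^ n * Q) [:- t0, 1:]" using undo by simp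
  then have "F = [:- t0, 1:] ^ n * pcompose Q [:- t0, 1:]" by (simp add: pcompose_mult comp pcompose_pCons)
  then show "[:- t0, 1:] ^ n dvd F" by (rule dvdI)
  show "\<not> [:- t0, 1:] ^ Suc n dvd F"
  proof
    assume "[:- t0, 1:] ^ Suc n dvd F"
    then obtain Q where "F = [:- t0, 1:] ^ Suc n * Q" by blast
    then have "pcompose F [:t0, 1:] = [:0, 1:] ^ Suc n * pcompose Q [:t0, 1:]"
      by (simp only: pcompose_mult comp) (simp add: pcompose_pCons)
    then show False using assms(2) by (metis dvdI)
  qed
qed

text \<open>By homogeneity \<open>f(v + t w)\<close> is \<open>t ^ d\<close> times \<open>f(w + v/t)\<close>, which is the reversal of the restriction
  of \<open>f\<close> to the line through \<open>w\<close> in direction \<open>v\<close>, up to a power of \<open>t\<close>.\<close>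

lemma line_poly_lead_coeff:
  assumes hom: "\<And>c x. poly_eval f (c *s x) = c ^ d * poly_eval f x" and nz: "poly_eval f w \<noteq> 0"
  shows "lead_coeff (line_poly f v w) = poly_eval f w"
proof -
  define H where "H = line_poly f w v"
  let ?N = "Polynomial.degree H"
  have H0: "Polynomial.coeff H 0 = poly_eval f w"
    using poly_line_poly[of f w v 0] by (simp add: H_def poly_0_coeff_0)
  \<comment> \<open>The additional factor \<open>t\<close> on both sides makes the identity hold at \<open>t = 0\<close> as well.\<close>
  have eq: "poly (Polynomial.monom 1 (Suc ?N) * line_poly f v w) t =
      poly (Polynomial.monom 1 (Suc d) * reflect_poly H) t" for t
  proof (cases "t = 0")
    case False
    have split: "v + t *s w = t *s (w + inverse t *s v)"
      using False by (simp add: vector_add_ldistrib vector_smult_assoc add.commute)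
    have "poly_eval f (v + t *s w) = t ^ d * poly H (inverse t)"
      unfolding split hom H_def poly_line_poly ..
    then show ?thesis
      using False by (simp add: poly_line_poly poly_monom poly_reflect_poly_nz)
  qed (simp add: poly_monom)
  then have "Polynomial.monom 1 (Suc ?N) * line_poly f v w = Polynomial.monom 1 (Suc d) * reflect_poly H"
    by (rule poly_eqI_all)
  then have "lead_coeff (Polynomial.monom 1 (Suc ?N) * line_poly f v w) =
      lead_coeff (Polynomial.monom 1 (Suc d) * reflect_poly H)" by (rule arg_cong)
  then have "lead_coeff (line_poly f v w) = lead_coeff (reflect_poly H)"
    by (simp only: lead_coeff_mult lead_coeff_monom mult_1_left)
  also have "\<dots> = Polynomial.coeff H 0"
    using nz H0 by (simp add: coeff_reflect_poly)
  finally show ?thesis using H0 by simp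
qed

lemma poly_eq_of_order_eq:
  fixes p q :: "complex poly"
  assumes nz: "p \<noteq> 0" "q \<noteq> 0" and ord: "\<And>t. Polynomial.order t p = Polynomial.order t q"
  shows "Polynomial.smult (lead_coeff q) p = Polynomial.smult (lead_coeff p) q"
proof -
  have "{z. poly p z = 0} = {z. poly q z = 0}"
    using nz ord by (auto simp: order_root)
  then have prod: "(\<Prod>z|poly p z = 0. [:-z, 1:] ^ Polynomial.order z p) = (\<Prod>z|poly q z = 0. [:-z, 1:] ^ Polynomial.order z q)"
    by (intro prod.cong) (simp_all add: ord)
  have "Polynomial.smult (lead_coeff q) p = Polynomial.smult (lead_coeff q)
      (Polynomial.smult (lead_coeff p) (\<Prod>z|poly p z = 0. [:-z, 1:] ^ Polynomial.order z p))"
    by (simp only: complex_poly_decompose)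
  also have "\<dots> = Polynomial.smult (lead_coeff p)
      (Polynomial.smult (lead_coeff q) (\<Prod>z|poly q z = 0. [:-z, 1:] ^ Polynomial.order z q))"
    by (simp only: prod smult_smult mult.commute)
  also have "\<dots> = Polynomial.smult (lead_coeff p) q"
    by (simp only: complex_poly_decompose)
  finally show ?thesis .
qed

lemma poly_eval_homogeneous:
  assumes "homogeneous_of_degree d f"
  shows "poly_eval f (c *s x) = c ^ d * poly_eval f x"
proof -
  have "Poly_Mapping.lookup f m * (\<Prod>i\<in>UNIV. (c * x $ i) ^ Poly_Mapping.lookup m i) =
      c ^ d * (Poly_Mapping.lookup f m * (\<Prod>i\<in>UNIV. (x $ i) ^ Poly_Mapping.lookup m i))"
    if "m \<in> Poly_Mapping.keys f" for m
  proof -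
    have "c ^ d = (\<Prod>i\<in>UNIV. c ^ Poly_Mapping.lookup m i)"
      using assms that by (simp add: homogeneous_of_degree_def flip: power_sum)
    then show ?thesis by (simp add: power_mult_distrib prod.distrib)
  qed
  then show ?thesis
    unfolding poly_eval_def sum_distrib_left vector_smult_component by (intro sum.cong refl)
qed

section \<open>Reflections and their hyperplanes\<close>

lemma grp_mult: "x \<otimes>\<^bsub>grp K S\<^esub> y = x ** y" "\<one>\<^bsub>grp K S\<^esub> = mat 1"
  by (simp_all add: GL_def units_of_def matrix_monoid_def)

lemma matrix_group_of_group:
  assumes "group (grp K S)" "finite S"
  shows "matrix_group S"
proof -
  interpret group "grp K S" by fact
  have one: "mat 1 \<in> S" using one_closed by (simp add: grp_mult)
  have inv: "invertible a \<and> matrix_inv a \<in> S" if "a \<in> S" for a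
  proof -
    have a: "a \<in> carrier (grp K S)" using that by simp
    note i = r_inv[OF a, unfolded grp_mult] l_inv[OF a, unfolded grp_mult]
    have "invertible a" using i unfolding invertible_def by blast
    moreover have "matrix_inv a = inv\<^bsub>grp K S\<^esub> a" using i by (rule matrix_inv_eqI)
    ultimately show ?thesis using inv_closed[OF a] by simp
  qed
  have "a ** b \<in> S" if "a \<in> S" "b \<in> S" for a b
    using m_closed[of a b] that unfolding grp_mult by simp
  then show ?thesis using one inv assms(2) by (simp add: matrix_group_def)
qed

lemma grp_nat_pow:
  fixes k :: nat
  assumes "group (grp K S)" "g \<in> S"
  shows "g [^]\<^bsub>grp K S\<^esub> k = mpow g k"
proof -
  interpret group "grp K S" by fact
  show ?thesis
  proof (induction k)
    case 0
    then show ?case by (simp only: nat_pow_0 grp_mult mpow_simps)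
  next
    case (Suc k)
    have "g \<in> carrier (grp K S)" using assms(2) by simp
    then show ?case by (simp only: nat_pow_Suc2 Suc.IH grp_mult mpow_simps)
  qed
qed

lemma grp_generate:
  assumes gr: "group (grp K S)" and fin: "finite S" and g: "g \<in> S"
  shows "generate (grp K S) {g} = range (mpow g)"
    and "mpow g k = mat 1 \<longleftrightarrow> card (generate (grp K S) {g}) dvd k"
proof -
  interpret group "grp K S" by fact
  have c: "g \<in> carrier (grp K S)" "finite (carrier (grp K S))" using g fin by simp_all
  show "generate (grp K S) {g} = range (mpow g)"
    using generate_pow_on_finite_carrier[OF c(2,1)] by (simp only: grp_nat_pow[OF gr g]) blast
  show "mpow g k = mat 1 \<longleftrightarrow> card (generate (grp K S) {g}) dvd k"
    using pow_eq_id[OF c(1), of k] unfolding grp_nat_pow[OF gr g] grp_mult generate_pow_card[OF c(1)] .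
qed

lemma grp_l_coset: "a <#\<^bsub>grp K S\<^esub> H = lcoset a H"
  unfolding l_coset_def lcoset_def grp_mult by blast

lemma grp_lcosets: "lcosets\<^bsub>grp K S\<^esub> G = (\<lambda>a. lcoset a G) ` S"
  unfolding LCOSETS_def grp_l_coset by auto

lemma twice_discr_exponent_eq:
  "twice_discr_exponent K S G P g = (\<Sum>i = 2..card ((\<lambda>a. lcoset a G) ` S).
     card (pointwise_stabilizer S P) * card {Z \<in> orbit (\<lambda>X. (**) g ` X) ` (\<lambda>a. lcoset a G) ` S. card Z = i} * (i - 1))"
  unfolding twice_discr_exponent_def num_cycles_def grp_lcosets grp_l_coset lcoset_def ..

text \<open>The fixed space of \<open>s\<close> is cut out by the rows of \<open>s - 1\<close>. It is a hyperplane if and only if the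
  nonzero rows are proportional to each other and at least one exists, so these finitely many forms
  describe all genericity conditions on points and lines.\<close>

definition row_forms :: "(complex^'n::finite^'n) set \<Rightarrow> (complex^'n) set" where
  "row_forms S = {(s - mat 1) $ i | s i. s \<in> S} - {0}"

lemma linform_row: "linform ((s - mat 1) $ i) x = (s *v x) $ i - x $ i"
proof -
  have "linform ((s - mat 1) $ i) x = ((s - mat 1) *v x) $ i"
    by (simp add: linform_def matrix_vector_mult_def)
  then show ?thesis by (simp add: matrix_vector_mult_diff_rdistrib)
qed

lemma finite_row_forms: "finite S \<Longrightarrow> finite (row_forms S)"
proof -
  assume "finite S"
  then have "finite ((\<lambda>(s, i). (s - mat 1) $ i) ` (S \<times> UNIV))" by simp
  then show ?thesis by (rule rev_finite_subset) (auto simp: row_forms_def)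
qed

lemma fixes_iff_row_forms: "s *v x = x \<longleftrightarrow> (\<forall>i. linform ((s - mat 1) $ i) x = 0)"
  unfolding linform_row by (simp add: vec_eq_iff)

lemma ex_row_form: "s \<in> S \<Longrightarrow> s \<noteq> mat 1 \<Longrightarrow> \<exists>i. (s - mat 1) $ i \<in> row_forms S"
proof -
  assume s: "s \<in> S" "s \<noteq> mat 1"
  then have "s - mat 1 \<noteq> 0" by simp
  then obtain i where "(s - mat 1) $ i \<noteq> 0" unfolding vec_eq_iff[of "s - mat 1" 0] zero_index by blast
  then show ?thesis using s(1) unfolding row_forms_def by blast
qed

text \<open>The hyperplanes are sets of points over \<open>K\<close>, while orders of vanishing are computed at complex
  points; proportionality of the forms carries incidence over. The vectors with at most two nonzero
  coordinates, \<open>a_i\<close> and \<open>- a_j\<close>, suffice as test vectors.\<close>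

lemma proportional_of_vanishing:
  assumes K: "number_field K" and a: "a \<in> space_over K" "a \<noteq> 0"
    and van: "\<And>x. x \<in> space_over K \<Longrightarrow> linform a x = 0 \<Longrightarrow> linform b x = 0"
  shows "\<exists>c. b = c *s a"
proof -
  have "\<exists>i. a $ i \<noteq> 0" using a(2) by (simp add: vec_eq_iff)
  then obtain i where i: "a $ i \<noteq> 0" by blast
  have "b $ j = (b $ i / a $ i) * a $ j" for j
  proof -
    \<comment> \<open>This vector lies in the kernel of \<open>a\<close> and has coordinates in \<open>K\<close>.\<close>
    define x where "x = a $ i *s axis j 1 - a $ j *s axis i (1::complex)"
    have sym: "linform u (axis k 1) = u $ k" for u :: "complex^'a" and k
      by (simp add: linform_def axis_def if_distrib[of "\<lambda>x. _ * x"] cong: if_cong)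
    have lin: "linform u x = a $ i * u $ j - a $ j * u $ i" for u :: "complex^'a"
      by (simp add: x_def sym)
    have "x \<in> space_over K"
    proof -
      have "a $ i * c - a $ j * d \<in> K" if "c \<in> K" "d \<in> K" for c d
        using a(1) that number_field_closed[OF K] unfolding space_over_def
        by (metis (mono_tags, lifting) diff_conv_add_uminus mem_Collect_eq)
      then show ?thesis
        using number_field_closed(1,2)[OF K] by (auto simp: space_over_def x_def axis_def)
    qed
    then have "linform b x = 0" using van lin[of a] by (simp add: mult.commute)
    then show ?thesis using lin[of b] i by (simp add: field_simps)
  qed
  then have "b = (b $ i / a $ i) *s a" unfolding vec_eq_iff vector_smult_component by blast
  then show ?thesis by blast
qed

lemma linear_form_of_degree_one:
  assumes "homogeneous_of_degree 1 (f :: ('n::finite) mpoly)"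
  defines "b \<equiv> (\<chi> i. Poly_Mapping.lookup f (Poly_Mapping.single i 1))"
  shows "poly_eval f x = linform b x"
proof -
  let ?e = "\<lambda>i. Poly_Mapping.single i (1::nat) :: 'n \<Rightarrow>\<^sub>0 nat"
  have sub: "Poly_Mapping.keys f \<subseteq> range ?e"
  proof
    fix m assume "m \<in> Poly_Mapping.keys f"
    then have s: "(\<Sum>i\<in>UNIV. Poly_Mapping.lookup m i) = 1" using assms(1) by (auto simp: homogeneous_of_degree_def)
    obtain i where i: "Poly_Mapping.lookup m i = 1" "\<And>j. i \<noteq> j \<Longrightarrow> Poly_Mapping.lookup m j = 0"
      using s unfolding sum_eq_1_iff[OF finite] by blast
    have "m = ?e i" by (rule poly_mapping_eqI) (use i in \<open>auto simp: lookup_single when_def\<close>)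
    then show "m \<in> range ?e" by blast
  qed
  have inj: "inj ?e" by (rule injI) (metis lookup_single_eq lookup_single_not_eq zero_neq_one)
  have prod: "(\<Prod>j\<in>UNIV. (x $ j) ^ Poly_Mapping.lookup (?e i) j) = x $ i" for i
    using poly_eval_Var[of i x] by (simp add: Var_def poly_eval_single)
  have "poly_eval f x = (\<Sum>m\<in>range ?e. Poly_Mapping.lookup f m * (\<Prod>i\<in>UNIV. (x $ i) ^ Poly_Mapping.lookup m i))"
    by (rule poly_eval_superset[OF _ sub]) simp
  also have "\<dots> = linform b x"
    unfolding sum.reindex[OF inj] o_def prod by (simp add: linform_def b_def)
  finally show ?thesis .
qed

section \<open>Comparison along generic lines\<close>

lemma order_linear_power:
  fixes \<alpha> \<beta> :: complex
  assumes "\<beta> \<noteq> 0"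
  shows "Polynomial.order t ([:\<alpha>, \<beta>:] ^ n) = (if \<alpha> + t * \<beta> = 0 then n else 0)"
proof (cases "\<alpha> + t * \<beta> = 0")
  case True
  then have "[:\<alpha>, \<beta>:] = Polynomial.smult \<beta> [:- t, 1:]" using assms by (simp add: add_eq_0_iff2 mult.commute)
  then have "[:\<alpha>, \<beta>:] ^ n = Polynomial.smult (\<beta> ^ n) ([:- t, 1:] ^ n)" by (simp only: smult_power)
  then show ?thesis using True assms by (simp add: order_smult order_power_n_n)
qed (simp add: order_0I)

lemma order_prod_linear:
  fixes \<alpha> \<beta> :: "'a \<Rightarrow> complex"
  assumes "finite A" "\<And>P. P \<in> A \<Longrightarrow> \<beta> P \<noteq> 0"
  shows "Polynomial.order t (\<Prod>P\<in>A. [:\<alpha> P, \<beta> P:] ^ e P) = (\<Sum>P\<in>A. if \<alpha> P + t * \<beta> P = 0 then e P else 0)"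
  using assms
proof (induction A rule: finite_induct)
  case empty
  show ?case by (simp add: order_0I)
next
  case (insert P A)
  have "[:\<alpha> P, \<beta> P:] ^ e P * (\<Prod>P\<in>A. [:\<alpha> P, \<beta> P:] ^ e P) \<noteq> 0"
    using insert by auto
  then show ?case using insert by (simp add: order_mult order_linear_power)
qed

text \<open>The direction \<open>w\<close> lies on no fixed space of a nontrivial element of \<open>S\<close>. If
  \<open>S\<close> is trivial there are no row forms, so that \<open>w\<close> has to be required nonzero separately.\<close>

locale discriminant_setting = coset_setting K S G \<theta> \<gamma>
  for K :: "complex set" and S G :: "(complex^'n::finite^'n) set"
    and \<theta> :: "'l::finite \<Rightarrow> 'n mpoly" and \<gamma> :: "'l \<Rightarrow> complex^'n^'n" +
  fixes L :: "(complex^'n) set \<Rightarrow> 'n mpoly" and g :: "(complex^'n) set \<Rightarrow> complex^'n^'n" and w :: "complex^'n"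
  assumes grp: "group (grp K S)"
    and L: "defining_forms K S L" and g: "stabilizer_generators K S g"
    and hom: "\<And>j. homogeneous (\<theta> j)"
    and w_rows: "\<And>a. a \<in> row_forms S \<Longrightarrow> linform a w \<noteq> 0" and w_nz: "w \<noteq> 0"
begin

abbreviation "mirrors \<equiv> reflecting_hyperplanes K S"
abbreviation "expnt P \<equiv> discr_exponent K S G P (g P)"

definition mirror_form :: "(complex^'n) set \<Rightarrow> complex^'n" where
  "mirror_form P = (\<chi> i. Poly_Mapping.lookup (L P) (Poly_Mapping.single i 1))"

lemma fin: "finite S"
  using S by (simp add: matrix_group_def)

lemma poly_eval_L: "P \<in> mirrors \<Longrightarrow> poly_eval (L P) x = linform (mirror_form P) x"
  using L linear_form_of_degree_one[of "L P"] by (simp add: defining_forms_def mirror_form_def)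

lemma mirror_form:
  assumes "P \<in> mirrors"
  shows "mirror_form P \<in> space_over K" "mirror_form P \<noteq> 0" "P = {x \<in> space_over K. linform (mirror_form P) x = 0}"
proof -
  have LP: "L P \<in> polys (ring_of_integers K)" "{v \<in> space_over K. poly_eval (L P) v = 0} = P"
    using L assms by (auto simp: defining_forms_def)
  show "mirror_form P \<in> space_over K"
    using LP(1) by (simp add: space_over_def mirror_form_def polys_def ring_of_integers_def)
  show P: "P = {x \<in> space_over K. linform (mirror_form P) x = 0}"
    using LP(2) poly_eval_L[OF assms] by simp
  obtain a where a: "a \<in> space_over K" "a \<noteq> 0" "P = {v \<in> space_over K. linform a v = 0}"
    using assms unfolding reflecting_hyperplanes_def hyperplane_def linform_def by blast
  show "mirror_form P \<noteq> 0"
  proof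
    assume "mirror_form P = 0"
    then have "P = space_over K" using P by simp
    moreover obtain i where i: "a $ i \<noteq> 0" using a(2) unfolding vec_eq_iff zero_index by blast
    moreover have "axis i 1 \<in> space_over K"
      using number_field_closed(1,2)[OF K] by (auto simp: space_over_def axis_def)
    ultimately have "linform a (axis i 1) = 0" using a(3) by blast
    then show False
      using i by (simp add: linform_def axis_def if_distrib[of "\<lambda>x. _ * x"] cong: if_cong)
  qed
qed

lemma row_in_K: "s \<in> S \<Longrightarrow> (s - mat 1) $ i \<in> space_over K"
  using entries number_field_closed(1,2,3,5)[OF K] unfolding space_over_def mat_def
  by (auto simp: diff_conv_add_uminus simp del: add_uminus_conv_diff)

lemma stabilizer_rows:
  assumes P: "P \<in> mirrors" and s: "s \<in> pointwise_stabilizer S P"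
  shows "\<exists>c. (s - mat 1) $ i = c *s mirror_form P"
proof (rule proportional_of_vanishing[OF K mirror_form(1,2)[OF P]])
  fix x assume "x \<in> space_over K" "linform (mirror_form P) x = 0"
  then have "x \<in> P" using mirror_form(3)[OF P] by blast
  then have "s *v x = x" using s by (simp add: pointwise_stabilizer_def)
  then show "linform ((s - mat 1) $ i) x = 0" unfolding fixes_iff_row_forms by blast
qed

lemma stabilizer_form:
  assumes P: "P \<in> mirrors" and s: "s \<in> pointwise_stabilizer S P"
  obtains u where "\<And>x. s *v x = x + linform (mirror_form P) x *s u"
proof -
  have "\<forall>i. \<exists>c. (s - mat 1) $ i = c *s mirror_form P" using stabilizer_rows[OF assms] by blast
  from choice[OF this] obtain c where c: "\<And>i. (s - mat 1) $ i = c i *s mirror_form P" by blast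
  have "s *v x = x + linform (mirror_form P) x *s (\<chi> i. c i)" for x
  proof -
    have "(s *v x) $ i - x $ i = c i * linform (mirror_form P) x" for i
      unfolding linform_row[symmetric] c by simp
    then show ?thesis by (simp add: vec_eq_iff algebra_simps)
  qed
  then show thesis by (rule that)
qed

lemma row_of_mirror:
  assumes P: "P \<in> mirrors"
  obtains b c where "b \<in> row_forms S" "c \<noteq> 0" "b = c *s mirror_form P"
proof -
  obtain s where s: "s \<noteq> mat 1" "s \<in> pointwise_stabilizer S P"
    using P unfolding reflecting_hyperplanes_def by blast
  then have "s \<in> S" by (simp add: pointwise_stabilizer_def)
  then obtain i where i: "(s - mat 1) $ i \<in> row_forms S" using ex_row_form s(1) by blast
  obtain c where c: "(s - mat 1) $ i = c *s mirror_form P" using stabilizer_rows[OF P s(2)] by blast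
  have "(s - mat 1) $ i \<noteq> 0" using i unfolding row_forms_def by blast
  then have "c \<noteq> 0" unfolding c by auto
  then show thesis using that[OF i _ c] by blast
qed

lemma mirror_form_w: "P \<in> mirrors \<Longrightarrow> linform (mirror_form P) w \<noteq> 0"
  by (rule row_of_mirror) (use w_rows in fastforce)+

lemma finite_mirrors: "finite mirrors"
proof -
  have "mirrors \<subseteq> (\<lambda>b. {x \<in> space_over K. linform b x = 0}) ` row_forms S"
  proof
    fix P assume P: "P \<in> mirrors"
    obtain b c where bc: "b \<in> row_forms S" "c \<noteq> 0" "b = c *s mirror_form P" by (rule row_of_mirror[OF P])
    have "P = {x \<in> space_over K. linform b x = 0}"
      by (subst mirror_form(3)[OF P]) (simp add: bc(2,3))
    then show "P \<in> (\<lambda>b. {x \<in> space_over K. linform b x = 0}) ` row_forms S" using bc(1) by blast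
  qed
  then show ?thesis using finite_row_forms[OF fin] finite_surj by blast
qed

definition secondary_det :: "'n mpoly" where
  "secondary_det = det (secondary_matrix \<gamma> \<theta>)"

lemma line_secondary_det: "line_poly secondary_det p u = det (\<chi> i j. line_poly (act (\<gamma> i) (\<theta> j)) p u)"
  by (rule poly_eqI_all) (simp add: poly_line_poly poly_det secondary_det_def poly_eval_det secondary_matrix_def)

lemma secondary_det_nonzero_at_free_point:
  assumes triv: "\<And>s. s \<in> S \<Longrightarrow> s *v p = p \<Longrightarrow> s = mat 1"
  shows "poly_eval secondary_det p \<noteq> 0"
proof -
  obtain i where i: "w $ i \<noteq> 0" using w_nz unfolding vec_eq_iff zero_index by blast
  interpret local_setting K S G \<theta> \<gamma> "mat 1" 1 1 p w 0 w "inverse (w $ i) *s axis i 1"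
  proof
    show "mat 1 \<in> S" using S by (simp add: matrix_group_def)
    show "\<exists>k. s = mpow (mat 1) k" if "s \<in> S" "s *v p = p" for s
      using triv[OF that] by (intro exI[of _ 0]) (simp add: mpow_simps)
  qed (use i in \<open>simp_all add: mpow_simps\<close>)
  have "local_order = 0" unfolding local_order_def using weight_less by (intro sum.neutral) (metis less_one)
  then have "\<not> [:0, 1:] dvd det line_matrix" using line_matrix_upper by simp
  then have "poly (det line_matrix) 0 \<noteq> 0" by (simp add: poly_eq_0_iff_dvd)
  then show ?thesis
    unfolding line_matrix_def line_secondary_det[symmetric] by (simp add: poly_line_poly)
qed

text \<open>A generator of \<open>C_P\<close> has the form \<open>x + a(x) u\<close>, so its \<open>k\<close>-th power adds
  \<open>(1 + \<zeta> + \<dots> + \<zeta> ^ (k-1)) a(x) u\<close> to \<open>x\<close>, where \<open>\<zeta> = 1 + a(u)\<close>. As the group is finite and the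
  characteristic zero, \<open>\<zeta> = 1\<close> is impossible: the generator is not a transvection, and \<open>\<zeta>\<close> is a root
  of unity of the same order as the generator. The transversal eigenvector is a multiple of \<open>u\<close>.\<close>

lemma order_at_reflecting_point:
  assumes P: "P \<in> mirrors" and p: "p = v + t0 *s w"
    and st: "{s \<in> S. s *v p = p} = pointwise_stabilizer S P"
  shows "Polynomial.order t0 (line_poly secondary_det v w) = expnt P"
proof -
  let ?g = "g P" and ?m = "card (pointwise_stabilizer S P)"
  define a where "a = inverse (linform (mirror_form P) w) *s mirror_form P"
  have gen_g: "generate (grp K S) {?g} = pointwise_stabilizer S P"
    using g P by (simp add: stabilizer_generators_def)
  then have gP: "?g \<in> pointwise_stabilizer S P" using generate.incl[of ?g "{?g}" "grp K S"] by auto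
  then have gS: "?g \<in> S" by (simp add: pointwise_stabilizer_def)
  note cyc = grp_generate[OF grp fin gS, unfolded gen_g]
  have a_w: "linform a w = 1" using mirror_form_w[OF P] by (simp add: a_def)
  obtain u' where u': "\<And>x. ?g *v x = x + linform (mirror_form P) x *s u'" by (rule stabilizer_form[OF P gP]) blast
  define u where "u = linform (mirror_form P) w *s u'"
  have gx: "?g *v x = x + linform a x *s u" for x
    using u'[of x] mirror_form_w[OF P] by (simp add: a_def u_def vector_smult_assoc)
  define \<zeta> where "\<zeta> = 1 + linform a u"
  have a_g: "linform a (?g *v x) = \<zeta> * linform a x" for x
    by (simp add: gx \<zeta>_def algebra_simps)
  have mp: "mpow ?g k *v x = x + (linform a x * (\<Sum>j<k. \<zeta> ^ j)) *s u" for k x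
  proof (induction k)
    case (Suc k)
    have ak: "linform a (mpow ?g k *v x) = \<zeta> ^ k * linform a x"
      by (induction k) (simp_all add: mpow_simps matrix_vector_mul_assoc[symmetric] a_g)
    have "mpow ?g (Suc k) *v x = mpow ?g k *v x + (\<zeta> ^ k * linform a x) *s u"
      by (simp add: mpow_simps matrix_vector_mul_assoc[symmetric] gx[of "mpow ?g k *v x"] ak)
    then show ?case by (simp add: Suc.IH vector_sadd_rdistrib algebra_simps)
  qed (simp add: mpow_simps)
  have m_pos: "?m > 0"
    using gP fin by (auto simp: card_gt_0_iff pointwise_stabilizer_def)
  obtain s0 where s0: "s0 \<noteq> mat 1" "s0 \<in> pointwise_stabilizer S P"
    using P unfolding reflecting_hyperplanes_def by blast
  have g1: "?g \<noteq> mat 1"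
  proof
    assume "?g = mat 1"
    then have "mpow ?g k = mat 1" for k by (induction k) (simp_all add: mpow_simps)
    then show False using s0 cyc(1) by auto
  qed
  have u0: "u \<noteq> 0"
  proof
    assume "u = 0"
    then have "?g *v x = mat 1 *v x" for x by (simp add: gx)
    then show False using g1 matrix_eq by blast
  qed
  have mp1: "mpow ?g k = mat 1 \<longleftrightarrow> (\<Sum>j<k. \<zeta> ^ j) = 0" for k
  proof
    assume "mpow ?g k = mat 1"
    then have "(\<Sum>j<k. \<zeta> ^ j) *s u = 0" using mp[of k w] a_w by simp
    then show "(\<Sum>j<k. \<zeta> ^ j) = 0" using u0 by simp
  next
    assume "(\<Sum>j<k. \<zeta> ^ j) = 0"
    then have "mpow ?g k *v x = mat 1 *v x" for x by (simp add: mp)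
    then show "mpow ?g k = mat 1" using matrix_eq by blast
  qed
  have \<zeta>1: "\<zeta> \<noteq> 1"
  proof
    assume one: "\<zeta> = 1"
    have "mpow ?g ?m = mat 1" unfolding cyc(2) by (rule dvd_refl)
    then have "(\<Sum>j<?m. \<zeta> ^ j) = 0" unfolding mp1 .
    then show False using m_pos unfolding one by simp
  qed
  have root: "\<zeta> ^ k = 1 \<longleftrightarrow> ?m dvd k" for k
    unfolding cyc(2)[symmetric] mp1 using geometric_sum[OF \<zeta>1, of k] \<zeta>1 by (simp add: atLeast0LessThan)
  define z where "z = inverse (\<zeta> - 1) *s u"
  have au: "linform a u = \<zeta> - 1" by (simp add: \<zeta>_def)
  have az: "linform a z = 1" using \<zeta>1 by (simp add: z_def au)
  \<comment> \<open>The component \<open>w - z\<close> of the direction lies in the kernel of \<open>a\<close>, hence is fixed.\<close>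
  interpret local_setting K S G \<theta> \<gamma> ?g \<zeta> ?m p w "w - z" z a
  proof
    show "\<exists>k. s = mpow ?g k" if "s \<in> S" "s *v p = p" for s
    proof -
      have "s \<in> range (mpow ?g)" using that st cyc(1) by blast
      then show ?thesis by blast
    qed
    show "?g *v p = p" using gP st by blast
    show "?g *v (w - z) = w - z" unfolding gx by (simp add: a_w az)
    have "u = (\<zeta> - 1) *s z" using \<zeta>1 by (simp add: z_def vector_smult_assoc)
    then show "?g *v z = \<zeta> *s z" unfolding gx az by (simp add: vector_ssub_ldistrib vec_eq_iff algebra_simps)
    show "mpow ?g ?m = mat 1" using cyc(2)[of ?m] by simp
  qed (use gS m_pos root a_g a_w in simp_all)
  have "2 * local_order = twice_discr_exponent K S G P ?g"
    unfolding local_order_def sum_weight twice_discr_exponent_eq ..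
  then have "local_order = expnt P" by (simp add: discr_exponent_def)
  moreover have "Polynomial.order t0 (line_poly secondary_det v w) = local_order"
  proof (rule order_pcompose_shift)
    have "pcompose (line_poly secondary_det v w) [:t0, 1:] = det line_matrix"
      by (simp only: line_poly_shift p[symmetric] line_secondary_det[of p w] line_matrix_def)
    then show "[:0, 1:] ^ local_order dvd pcompose (line_poly secondary_det v w) [:t0, 1:]"
      "\<not> [:0, 1:] ^ Suc local_order dvd pcompose (line_poly secondary_det v w) [:t0, 1:]"
      using line_matrix_lower line_matrix_upper by simp_all
  qed
  ultimately show ?thesis by simp
qed

text \<open>The form in \<open>v\<close> that vanishes if and only if the zero sets of \<open>a\<close> and \<open>b\<close> meet the line \<open>v + t w\<close> in
  the same point. It is zero only for proportional \<open>a\<close> and \<open>b\<close>, because \<open>w\<close> is generic.\<close>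

definition pair_forms :: "(complex^'n) set" where
  "pair_forms = (\<lambda>(a, b). linform b w *s a - linform a w *s b) ` (row_forms S \<times> row_forms S) - {0}"

lemma finite_pair_forms: "finite pair_forms" "0 \<notin> pair_forms"
  using finite_row_forms[OF fin] by (simp_all add: pair_forms_def)

lemma rows_proportional:
  assumes v: "\<And>c. c \<in> pair_forms \<Longrightarrow> linform c v \<noteq> 0" and p: "p = v + t0 *s w"
    and a: "a \<in> row_forms S" "linform a p = 0" and b: "b \<in> row_forms S" "linform b p = 0"
  shows "linform b w *s a = linform a w *s b"
proof (rule ccontr)
  assume "linform b w *s a \<noteq> linform a w *s b"
  then have "linform b w *s a - linform a w *s b \<in> pair_forms"
    using a(1) b(1) by (auto simp: pair_forms_def)
  then have "linform (linform b w *s a - linform a w *s b) v \<noteq> 0" by (rule v)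
  moreover have "linform a v = - (t0 * linform a w)" "linform b v = - (t0 * linform b w)"
    using a(2) b(2) by (simp_all add: p add_eq_0_iff2)
  ultimately show False by (simp add: algebra_simps)
qed

text \<open>All rows of \<open>s - 1\<close>, for all \<open>s\<close> in the stabilizer of \<open>p\<close>, are forms vanishing at \<open>p\<close>, hence
  proportional to one of them. So the whole stabilizer consists of reflections in one hyperplane.\<close>

lemma stabilizer_on_generic_line:
  assumes v: "\<And>c. c \<in> pair_forms \<Longrightarrow> linform c v \<noteq> 0" and p: "p = v + t0 *s w"
    and s0: "s0 \<in> S" "s0 \<noteq> mat 1" "s0 *v p = p"
  obtains P where "P \<in> mirrors" "{s \<in> S. s *v p = p} = pointwise_stabilizer S P" "linform (mirror_form P) p = 0"
proof -
  obtain i where i: "(s0 - mat 1) $ i \<in> row_forms S" using ex_row_form[OF s0(1,2)] by blast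
  define b where "b = (s0 - mat 1) $ i"
  have b: "b \<in> row_forms S" "linform b p = 0" "b \<in> space_over K" "b \<noteq> 0"
    using i s0(3) row_in_K[OF s0(1), of i] unfolding b_def fixes_iff_row_forms by (auto simp: row_forms_def)
  define P where "P = {x \<in> space_over K. linform b x = 0}"
  have hyp: "hyperplane K P" unfolding hyperplane_def P_def linform_def using b(3,4) by blast
  have sub: "s \<in> pointwise_stabilizer S P" if s: "s \<in> S" "s *v p = p" for s
  proof -
    have "s *v x = x" if x: "x \<in> P" for x
      unfolding fixes_iff_row_forms
    proof
      fix k
      define r where "r = (s - mat 1) $ k"
      have rp: "linform r p = 0" using s(2) unfolding r_def fixes_iff_row_forms by blast
      have "linform r x = 0"
      proof (cases "r = 0")
        case False
        then have "r \<in> row_forms S" using s(1) by (auto simp: row_forms_def r_def)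
        then have "linform b w *s r = linform r w *s b" using rows_proportional[OF v p _ rp b(1,2)] by blast
        then have "linform (linform b w *s r) x = linform (linform r w *s b) x" by simp
        then have "linform b w * linform r x = linform r w * linform b x" by (simp only: linform_simps)
        then show ?thesis using x w_rows[OF b(1)] by (simp add: P_def)
      qed simp
      then show "linform ((s - mat 1) $ k) x = 0" by (simp only: r_def)
    qed
    then show ?thesis using s(1) by (simp add: pointwise_stabilizer_def)
  qed
  have P: "P \<in> mirrors" using hyp sub[OF s0(1,3)] s0(2) unfolding reflecting_hyperplanes_def by blast
  have "\<exists>c. b = c *s mirror_form P"
    by (rule proportional_of_vanishing[OF K mirror_form(1,2)[OF P]]) (use mirror_form(3)[OF P] P_def in blast)
  then obtain c where c: "b = c *s mirror_form P" by blast
  then have "c \<noteq> 0" using b(4) by auto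
  then have ep: "linform (mirror_form P) p = 0" using b(2) by (simp add: c)
  have "s *v p = p" if s: "s \<in> pointwise_stabilizer S P" for s
  proof -
    obtain u where "\<And>x. s *v x = x + linform (mirror_form P) x *s u" by (rule stabilizer_form[OF P s]) blast
    then show ?thesis using ep by simp
  qed
  then have "{s \<in> S. s *v p = p} = pointwise_stabilizer S P"
    using sub by (auto simp: pointwise_stabilizer_def)
  then show thesis using that P ep by blast
qed

lemma mirror_on_generic_line:
  assumes v: "\<And>c. c \<in> pair_forms \<Longrightarrow> linform c v \<noteq> 0" and p: "p = v + t0 *s w"
    and P: "P \<in> mirrors" "linform (mirror_form P) p = 0" and P': "P' \<in> mirrors" "linform (mirror_form P') p = 0"
  shows "P = P'"
proof -
  obtain b c where bc: "b \<in> row_forms S" "c \<noteq> 0" "b = c *s mirror_form P" by (rule row_of_mirror[OF P(1)])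
  obtain b' c' where bc': "b' \<in> row_forms S" "c' \<noteq> 0" "b' = c' *s mirror_form P'" by (rule row_of_mirror[OF P'(1)])
  have "linform b' w *s b = linform b w *s b'"
    by (rule rows_proportional[OF v p bc(1) _ bc'(1)]) (simp_all add: bc(3) bc'(3) P(2) P'(2))
  then have "linform b' w * linform b x = linform b w * linform b' x" for x
    by (metis linform_simps(7))
  then have "linform b x = 0 \<longleftrightarrow> linform b' x = 0" for x
    using w_rows[OF bc(1)] w_rows[OF bc'(1)] by (metis mult_eq_0_iff)
  then have "linform (mirror_form P) x = 0 \<longleftrightarrow> linform (mirror_form P') x = 0" for x
    using bc(2) bc'(2) unfolding bc(3) bc'(3) by simp
  then show ?thesis using mirror_form(3)[OF P(1)] mirror_form(3)[OF P'(1)] by simp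
qed

lemma order_on_generic_line:
  assumes v: "\<And>c. c \<in> pair_forms \<Longrightarrow> linform c v \<noteq> 0"
  shows "Polynomial.order t0 (line_poly secondary_det v w) =
    (\<Sum>P\<in>mirrors. if linform (mirror_form P) v + t0 * linform (mirror_form P) w = 0 then expnt P else 0)"
proof -
  define p where "p = v + t0 *s w"
  have lin: "linform (mirror_form P) v + t0 * linform (mirror_form P) w = linform (mirror_form P) p" for P by (simp add: p_def)
  show ?thesis
  proof (cases "\<exists>s\<in>S. s \<noteq> mat 1 \<and> s *v p = p")
    case True
    then obtain s0 where s0: "s0 \<in> S" "s0 \<noteq> mat 1" "s0 *v p = p" by blast
    obtain P where P: "P \<in> mirrors" "{s \<in> S. s *v p = p} = pointwise_stabilizer S P" "linform (mirror_form P) p = 0"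
      by (rule stabilizer_on_generic_line[OF v p_def s0])
    have "linform (mirror_form P') p = 0 \<longleftrightarrow> P' = P" if P': "P' \<in> mirrors" for P'
    proof
      assume e: "linform (mirror_form P') p = 0"
      show "P' = P" by (rule mirror_on_generic_line[OF v p_def P' e P(1,3)])
    qed (simp only: P(3))
    then have "(\<Sum>P'\<in>mirrors. if linform (mirror_form P') p = 0 then expnt P' else 0) = (\<Sum>P'\<in>mirrors. if P' = P then expnt P' else 0)"
      by (intro sum.cong refl) (simp only:)
    also have "\<dots> = expnt P" using P(1) finite_mirrors by simp
    finally show ?thesis unfolding lin order_at_reflecting_point[OF P(1) p_def P(2)] by simp
  next
    case False
    have "linform (mirror_form P) p \<noteq> 0" if P: "P \<in> mirrors" for P
    proof
      assume e: "linform (mirror_form P) p = 0"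
      obtain s where s: "s \<noteq> mat 1" "s \<in> pointwise_stabilizer S P"
        using P unfolding reflecting_hyperplanes_def by blast
      obtain u where "\<And>x. s *v x = x + linform (mirror_form P) x *s u" by (rule stabilizer_form[OF P s(2)]) blast
      then have "s *v p = p" using e by simp
      then show False using False s by (auto simp: pointwise_stabilizer_def)
    qed
    then have "(\<Sum>P\<in>mirrors. if linform (mirror_form P) p = 0 then expnt P else 0) = 0" by (intro sum.neutral) auto
    moreover have "Polynomial.order t0 (line_poly secondary_det v w) = 0"
      using secondary_det_nonzero_at_free_point[of p] False by (intro order_0I) (auto simp: poly_line_poly p_def)
    ultimately show ?thesis unfolding lin by simp
  qed
qed

lemma secondary_det_homogeneous: "\<exists>d. \<forall>c x. poly_eval secondary_det (c *s x) = c ^ d * poly_eval secondary_det x"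
proof -
  have "\<forall>j. \<exists>d. homogeneous_of_degree d (\<theta> j)" using hom unfolding homogeneous_def by blast
  from choice[OF this] obtain d where d: "\<And>j. homogeneous_of_degree (d j) (\<theta> j)" by blast
  have "poly_eval secondary_det (c *s x) = c ^ (\<Sum>j\<in>UNIV. d j) * poly_eval secondary_det x" for c x
  proof -
    have "poly_eval secondary_det (c *s x) = det (\<chi> i j. (\<chi> i j. poly_eval (act (\<gamma> i) (\<theta> j)) x) $ i $ j * c ^ d j)"
      unfolding secondary_det_def poly_eval_det secondary_matrix_def
      by (simp add: poly_eval_act vector_scalar_commute poly_eval_homogeneous[OF d] mult.commute)
    also have "\<dots> = poly_eval secondary_det x * c ^ (\<Sum>j\<in>UNIV. d j)"
      unfolding det_scale_columns by (simp add: secondary_det_def poly_eval_det secondary_matrix_def power_sum)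
    finally show ?thesis by (simp only: mult.commute)
  qed
  then show ?thesis by blast
qed

abbreviation "\<Delta> \<equiv> discriminant K S G L g"

lemma poly_eval_\<Delta>: "poly_eval \<Delta> x = (\<Prod>P\<in>mirrors. linform (mirror_form P) x ^ expnt P)"
  unfolding discriminant_def poly_eval_prod poly_eval_power by (intro prod.cong refl) (simp add: poly_eval_L)

lemma line_\<Delta>: "line_poly \<Delta> v w = (\<Prod>P\<in>mirrors. [:linform (mirror_form P) v, linform (mirror_form P) w:] ^ expnt P)"
  by (rule poly_eqI_all) (simp add: poly_line_poly poly_eval_\<Delta> poly_prod)

lemma \<Delta>_homogeneous: "poly_eval \<Delta> (c *s x) = c ^ (\<Sum>P\<in>mirrors. expnt P) * poly_eval \<Delta> x"
  by (simp add: poly_eval_\<Delta> power_mult_distrib prod.distrib power_sum)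

lemma \<Delta>_w: "poly_eval \<Delta> w \<noteq> 0"
  using mirror_form_w finite_mirrors by (simp add: poly_eval_\<Delta>)

lemma secondary_det_w: "poly_eval secondary_det w \<noteq> 0"
proof (rule secondary_det_nonzero_at_free_point, rule ccontr)
  fix s assume s: "s \<in> S" "s *v w = w" "s \<noteq> mat 1"
  then obtain i where "(s - mat 1) $ i \<in> row_forms S" using ex_row_form by blast
  then show False using w_rows s(2) unfolding fixes_iff_row_forms by blast
qed

lemma secondary_det_eq: "secondary_det = Const (poly_eval secondary_det w / poly_eval \<Delta> w) * \<Delta>"
proof (rule poly_eval_generic_eq[OF finite_pair_forms])
  fix v assume v: "\<And>c. c \<in> pair_forms \<Longrightarrow> linform c v \<noteq> 0"
  obtain d where d: "\<And>c x. poly_eval secondary_det (c *s x) = c ^ d * poly_eval secondary_det x" using secondary_det_homogeneous by blast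
  have leads: "lead_coeff (line_poly secondary_det v w) = poly_eval secondary_det w" "lead_coeff (line_poly \<Delta> v w) = poly_eval \<Delta> w"
    using line_poly_lead_coeff[OF d secondary_det_w] line_poly_lead_coeff[OF \<Delta>_homogeneous \<Delta>_w] by blast+
  have "Polynomial.smult (lead_coeff (line_poly \<Delta> v w)) (line_poly secondary_det v w) =
      Polynomial.smult (lead_coeff (line_poly secondary_det v w)) (line_poly \<Delta> v w)"
  proof (rule poly_eq_of_order_eq)
    show "line_poly secondary_det v w \<noteq> 0" "line_poly \<Delta> v w \<noteq> 0" using leads secondary_det_w \<Delta>_w by auto
    show "Polynomial.order t (line_poly secondary_det v w) = Polynomial.order t (line_poly \<Delta> v w)" for t
    proof -
      have "Polynomial.order t (line_poly secondary_det v w) =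
          (\<Sum>P\<in>mirrors. if linform (mirror_form P) v + t * linform (mirror_form P) w = 0 then expnt P else 0)"
        by (rule order_on_generic_line[OF v])
      also have "\<dots> = Polynomial.order t (line_poly \<Delta> v w)"
        unfolding line_\<Delta> by (rule order_prod_linear[OF finite_mirrors mirror_form_w, symmetric])
      finally show ?thesis .
    qed
  qed
  then have "poly (Polynomial.smult (poly_eval \<Delta> w) (line_poly secondary_det v w)) 0 =
      poly (Polynomial.smult (poly_eval secondary_det w) (line_poly \<Delta> v w)) 0" unfolding leads by (rule arg_cong)
  then show "poly_eval secondary_det v = poly_eval (Const (poly_eval secondary_det w / poly_eval \<Delta> w) * \<Delta>) v"
    using \<Delta>_w by (simp add: poly_line_poly poly_eval_simps field_simps)
qed

end

theorem mainTheorem4: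
  fixes K :: "complex set"
    and S G :: "(complex^'n::finite^'n) set"
    and \<theta> :: "'l::finite \<Rightarrow> 'n mpoly"
    and \<gamma> :: "'l \<Rightarrow> complex^'n^'n"
    and L :: "(complex^'n) set \<Rightarrow> 'n mpoly"
    and g :: "(complex^'n) set \<Rightarrow> complex^'n^'n"
  assumes "number_field K"
    and "finite_unitary_reflection_group K S"
    and "subgroup G (grp K S)"
    and "CARD('l) = card (lcosets\<^bsub>grp K S\<^esub> G)"
    and "secondaries K S G \<theta>"
    and "left_coset_reps K S G \<gamma>"
    and "defining_forms K S L"
    and "stabilizer_generators K S g"
  shows "\<exists>c\<in>K. det (secondary_matrix \<gamma> \<theta>) = Const c * discriminant K S G L g"
proof -
  note K = assms(1)
  have grpS: "group (grp K S)" by (rule group_grp[OF assms(2)])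
  have finS: "finite S" and subS: "subgroup S (GL (ring_of_integers K))"
    using assms(2) by (simp_all add: finite_unitary_reflection_group_def)
  have S: "matrix_group S" by (rule matrix_group_of_group[OF grpS finS])
  have GS: "G \<subseteq> S" using subgroup.subset[OF assms(3)] by simp
  have "group ((grp K S)\<lparr>carrier := G\<rparr>)" by (rule subgroup.subgroup_is_group[OF assms(3) grpS])
  then have "group (grp K G)" by simp
  then have G: "matrix_group G" by (rule matrix_group_of_group) (rule finite_subset[OF GS finS])
  have entries: "s $ i $ j \<in> K" if "s \<in> S" for s i j
    using subgroup.subset[OF subS] that
    by (auto simp: GL_def units_of_def Units_def matrix_monoid_def ring_of_integers_def)
  have \<theta>: "\<theta> j \<in> invariants (ring_of_integers K) G" "homogeneous (\<theta> j)" for j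
    using assms(5) by (auto simp: secondaries_def)
  have gen: "generates_invariants K S G \<theta> UNIV" using assms(5) by (simp add: secondaries_def)
  \<comment> \<open>A coordinate form is added to the row forms so that the direction is nonzero even for trivial \<open>S\<close>.\<close>
  have fin_rows: "finite (insert (axis undefined 1) (row_forms S))" "0 \<notin> insert (axis undefined 1) (row_forms S)"
    using finite_row_forms[OF finS] by (auto simp: row_forms_def)
  obtain N :: "'n \<Rightarrow> nat" where N: "\<forall>a\<in>insert (axis undefined 1) (row_forms S). linform a (\<chi> i. of_nat (N i)) \<noteq> 0"
    using exists_nat_point_off_hyperplanes[OF fin_rows] by blast
  define w :: "complex^'n" where "w = (\<chi> i. of_nat (N i))"
  interpret discriminant_setting K S G \<theta> \<gamma> L g w
  proof (intro discriminant_setting.intro coset_setting.intro discriminant_setting_axioms.intro)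
    show "number_field K" by (fact K)
    show "matrix_group S" by (fact S)
    show "matrix_group G" by (fact G)
    show "G \<subseteq> S" by (fact GS)
    show "s $ i $ j \<in> K" if "s \<in> S" for s i j by (rule entries[OF that])
    show "generates_invariants K S G \<theta> UNIV" by (fact gen)
    show "group (grp K S)" by (fact grpS)
    show "defining_forms K S L" by (fact assms)
    show "stabilizer_generators K S g" by (fact assms)
    show "act h (\<theta> j) = \<theta> j" if "h \<in> G" for h j using \<theta>(1)[of j] that by (simp add: invariants_def)
    show "\<gamma> i \<in> S" for i using assms(6) by (auto simp: left_coset_reps_def)
    show "bij_betw (\<lambda>i. lcoset (\<gamma> i) G) UNIV ((\<lambda>a. lcoset a G) ` S)"
      using assms(6) unfolding left_coset_reps_def grp_lcosets grp_l_coset by blast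
    show "homogeneous (\<theta> j)" for j by (rule \<theta>(2))
    show "linform a w \<noteq> 0" if "a \<in> row_forms S" for a using N that by (simp add: w_def)
    have "linform (axis undefined 1) w \<noteq> 0" using N by (simp add: w_def)
    then show "w \<noteq> 0" by auto
  qed
  have w: "w \<in> space_over K"
  proof -
    have "of_nat k \<in> K" for k by (induction k) (simp_all add: number_field_closed[OF K])
    then show ?thesis by (simp add: w_def space_over_def)
  qed
  have "poly_eval secondary_det w \<in> K"
  proof -
    have "act (\<gamma> i) (\<theta> j) \<in> polys K" for i j
      using \<theta>(1)[of j] entries matrix_group_memD(2)[OF S \<gamma>_in]
      by (intro polys_act[OF K]) (auto simp: invariants_def polys_def ring_of_integers_def)
    then have "poly_eval (act (\<gamma> i) (\<theta> j)) w \<in> K" for i j by (rule poly_eval_in_field[OF K _ w])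
    moreover have "of_int (sign q) \<in> K" for q :: "'l \<Rightarrow> 'l"
      by (cases q rule: sign_cases) (simp_all add: number_field_closed[OF K])
    ultimately show ?thesis
      unfolding secondary_det_def poly_eval_det secondary_matrix_def unfolding det_def
      by (simp add: number_field_sum[OF K] number_field_prod[OF K] number_field_closed[OF K])
  qed
  moreover have "poly_eval \<Delta> w \<in> K"
  proof -
    have "linform (mirror_form P) w \<in> K" if "P \<in> mirrors" for P
      using mirror_form(1)[OF that] w unfolding linform_def space_over_def
      by (auto intro!: number_field_sum[OF K] number_field_closed[OF K])
    then show ?thesis unfolding poly_eval_\<Delta> by (intro number_field_prod[OF K] number_field_power[OF K])
  qed
  ultimately have "poly_eval secondary_det w / poly_eval \<Delta> w \<in> K"
    unfolding divide_inverse by (intro number_field_closed[OF K])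
  then show ?thesis using secondary_det_eq unfolding secondary_det_def by blast
qed

end
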